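(* Let $p$ be a prime, let $k\ge 2$ be an integer, and let $\mathcal D$ be a connected LC instance. Then $\mathcal D$ has a solution in the minion $\mathcal V_k\text{-}\mathbb Z_p$ if and only if the $k$-th saturated power $\mathrm{pow}_k\,\mathcal D$ of $\mathcal D$ has a solution in the minion $\mathcal Z_p$.
   Context: An LC (label cover) instance $\mathcal D$ consists of a finite set $X$ of variables, a finite set $\mathcal D_x$ (domain) for each $x\in X$, and a finite list of constraints of the form $x=\alpha(y)$ with $x,y\in X$ and $\alpha:\mathcal D_y\to\mathcal D_x$ a function. It is connected if the multigraph with vertex set $X$ and an edge between $x$ and $y$ for each constraint $x=\alpha(y)$ is connected. A minion $\mathcal R$ is a functor from finite sets to sets: it assigns a set $\mathcal R^{(D)}$ to each finite set $D$ and a map $\mathcal R^{(\alpha)}:\mathcal R^{(D)}\to\mathcal R^{(E)}$ to each function $\alpha:D\to E$ between finite sets, preserving identities and composition. A solution of $\mathcal D$ in $\mathcal R$ is a tuple $(r_x)_{x\in X}$ with $r_x\in\mathcal R^{(\mathcal D_x)}$ and $r_x=\mathcal R^{(\alpha)}(r_y)$ for every constraint $x=\alpha(y)$ of $\mathcal D$. The $k$-th saturated power $\mathrm{pow}_k\,\mathcal D$ is the LC instance with variable set $X^k$, domains $\mathcal D_{x_1x_2\dots x_k}=\mathcal D_{x_1}\times\cdots\times\mathcal D_{x_k}$, and the following constraints, where first all constraints $x=\mathrm{id}(x)$ ($x\in X$) are added to $\mathcal D$: (1) for every $k$-tuple of constraints $x_i=\alpha_i(y_i)$, $i=1,\dots,k$,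 of $\mathcal D$, the constraint $x_1\dots x_k=(\alpha_1\times\cdots\times\alpha_k)(y_1\dots y_k)$; (2) for every $x_1\dots x_k\in X^k$ and every function $\sigma:[k]\to[k]$, the constraint $x_{\sigma(1)}\dots x_{\sigma(k)}=\sigma^*(x_1\dots x_k)$, where $\sigma^*(d_1\dots d_k)=d_{\sigma(1)}\dots d_{\sigma(k)}$. The minion $\mathcal Z_p$: $\mathcal Z_p^{(D)}=\{f:D\to\mathbb Z_p\mid\sum_{a\in D}f(a)=1\}$, and for $\alpha:D\to E$, $\mathcal Z_p^{(\alpha)}(f)(b)=\sum_{a\in\alpha^{-1}(b)}f(a)$. The minion $\mathcal V_k\text{-}\mathbb Z_p$: all computations are in the field $\mathbb Z_p$; for vectors in $\mathbb Z_p^N$ let $\mathfrak w(v_1,\dots,v_N)=v_1+\cdots+v_N$ and let $\odot$ denote the componentwise product. For a finite set $D$, $(\mathcal V_k\text{-}\mathbb Z_p)^{(D)}$ is the set of triples $(V,\mathbf i,\mathbf v)$ where $V$ is a linear subspace of $\mathbb Z_p^N$ for some $N\in\mathbb N$, $\mathbf i\in V$, and $\mathbf v:D\to V$, such that: (i) $\mathbf i=(1,1,\dots,1)$ and $\mathfrak w(\mathbf i)=1$; (s) $\sum_{a\in D}\mathbf v(a)=\mathbf i$; (o) $\mathfrak w(\mathbf v(a)\odot\mathbf v(b)\odot\mathbf u_1\odot\cdots\odot\mathbf u_{k-2})=0$ for all $a\ne b$ in $D$ and all $\mathbf u_1,\dots,\mathbf u_{k-2}\in V$; (p) $\mathfrak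 w(\mathbf v(a)\odot\mathbf v(a)\odot\mathbf u_1\odot\cdots\odot\mathbf u_{k-2})=\mathfrak w(\mathbf v(a)\odot\mathbf u_1\odot\cdots\odot\mathbf u_{k-2})$ for all $a\in D$ and all $\mathbf u_1,\dots,\mathbf u_{k-2}\in V$. For $\alpha:D\to E$, $(\mathcal V_k\text{-}\mathbb Z_p)^{(\alpha)}(V,\mathbf i,\mathbf v)=(V,\mathbf i,\mathbf v')$ with $\mathbf v'(b)=\sum_{a\in\alpha^{-1}(b)}\mathbf v(a)$. *)

theory Defs
  imports
    "HOL-Library.FuncSet"
    "Berlekamp_Zassenhaus.Finite_Field"
    "Jordan_Normal_Form.VS_Connect"
begin

section \<open>Label cover instances\<close>

text \<open>A constraint \<open>x = \<alpha>(y)\<close> is the triple \<open>(x, \<alpha>, y)\<close>. The domains of one instance are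
  subsets of a common type \<open>'d\<close>, and only the values of \<open>\<alpha>\<close> on the domain of \<open>y\<close> matter.\<close>

type_synonym ('x, 'd) lc_constraint = "'x \<times> ('d \<Rightarrow> 'd) \<times> 'x"

record ('x, 'd) lc =
  lc_vars :: "'x set"
  lc_dom :: "'x \<Rightarrow> 'd set"
  lc_constraints :: "('x, 'd) lc_constraint set"

definition lc_instance :: "('x, 'd) lc \<Rightarrow> bool" where
  "lc_instance \<D> \<longleftrightarrow>
     finite (lc_vars \<D>) \<and>
     (\<forall>x\<in>lc_vars \<D>. finite (lc_dom \<D> x)) \<and>
     finite (lc_constraints \<D>) \<and>
     (\<forall>(x, \<alpha>, y)\<in>lc_constraints \<D>.
        x \<in> lc_vars \<D> \<and> y \<in> lc_vars \<D> \<and> \<alpha> \<in> lc_dom \<D> y \<rightarrow> lc_dom \<D> x)"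

definition lc_edges :: "('x, 'd) lc \<Rightarrow> ('x \<times> 'x) set" where
  "lc_edges \<D> = {(x, y). \<exists>\<alpha>. (x, \<alpha>, y) \<in> lc_constraints \<D>}"

definition lc_connected :: "('x, 'd) lc \<Rightarrow> bool" where
  "lc_connected \<D> \<longleftrightarrow>
     (\<forall>x\<in>lc_vars \<D>. \<forall>y\<in>lc_vars \<D>. (x, y) \<in> (lc_edges \<D> \<union> (lc_edges \<D>)\<inverse>)\<^sup>*)"


section \<open>Minions and solutions\<close>

text \<open>The part of a minion that lives on the finite subsets of one type \<open>'d\<close>. A function between
  finite sets is given by its source, its target and a function on the whole type; the last
  clause of \<open>is_minion\<close> says that its values outside the source are irrelevant. The concrete
  minions below are polymorphic in \<open>'d\<close>, so that they are available on all finite sets.\<close>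

record ('d, 'r) minion =
  obj :: "'d set \<Rightarrow> 'r set"
  arr :: "'d set \<Rightarrow> 'd set \<Rightarrow> ('d \<Rightarrow> 'd) \<Rightarrow> 'r \<Rightarrow> 'r"

definition is_minion :: "('d, 'r) minion \<Rightarrow> bool" where
  "is_minion \<R> \<longleftrightarrow>
     (\<forall>D E \<alpha> r. finite D \<longrightarrow> finite E \<longrightarrow> \<alpha> \<in> D \<rightarrow> E \<longrightarrow> r \<in> obj \<R> D \<longrightarrow> arr \<R> D E \<alpha> r \<in> obj \<R> E) \<and>
     (\<forall>D r. finite D \<longrightarrow> r \<in> obj \<R> D \<longrightarrow> arr \<R> D D id r = r) \<and>
     (\<forall>D E F \<alpha> \<beta> r. finite D \<longrightarrow> finite E \<longrightarrow> finite F \<longrightarrow> \<alpha> \<in> D \<rightarrow> E \<longrightarrow> \<beta> \<in> E \<rightarrow> F \<longrightarrow>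
        r \<in> obj \<R> D \<longrightarrow> arr \<R> D F (\<beta> \<circ> \<alpha>) r = arr \<R> E F \<beta> (arr \<R> D E \<alpha> r)) \<and>
     (\<forall>D E \<alpha> \<alpha>' r. finite D \<longrightarrow> finite E \<longrightarrow> \<alpha> \<in> D \<rightarrow> E \<longrightarrow> (\<forall>a\<in>D. \<alpha> a = \<alpha>' a) \<longrightarrow>
        r \<in> obj \<R> D \<longrightarrow> arr \<R> D E \<alpha> r = arr \<R> D E \<alpha>' r)"

definition lc_solution :: "('d, 'r) minion \<Rightarrow> ('x, 'd) lc \<Rightarrow> ('x \<Rightarrow> 'r) \<Rightarrow> bool" where
  "lc_solution \<R> \<D> r \<longleftrightarrow>
     (\<forall>x\<in>lc_vars \<D>. r x \<in> obj \<R> (lc_dom \<D> x)) \<and>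
     (\<forall>(x, \<alpha>, y)\<in>lc_constraints \<D>. r x = arr \<R> (lc_dom \<D> y) (lc_dom \<D> x) \<alpha> (r y))"

definition has_solution :: "('d, 'r) minion \<Rightarrow> ('x, 'd) lc \<Rightarrow> bool" where
  "has_solution \<R> \<D> \<longleftrightarrow> (\<exists>r. lc_solution \<R> \<D> r)"


section \<open>Saturated powers\<close>

text \<open>Elements of \<open>X\<^sup>k\<close> and of products of \<open>k\<close> domains are lists of length \<open>k\<close>; positions are
  numbered from \<open>0\<close>, so \<open>[k]\<close> becomes \<open>{..<k}\<close>.\<close>

definition add_id_constraints :: "('x, 'd) lc \<Rightarrow> ('x, 'd) lc_constraint set" where
  "add_id_constraints \<D> = lc_constraints \<D> \<union> {(x, id, x) | x. x \<in> lc_vars \<D>}"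

definition prod_map :: "('d \<Rightarrow> 'd) list \<Rightarrow> 'd list \<Rightarrow> 'd list" where
  "prod_map \<alpha>s ds = map2 (\<lambda>\<alpha> d. \<alpha> d) \<alpha>s ds"

definition reindex :: "nat \<Rightarrow> (nat \<Rightarrow> nat) \<Rightarrow> 'a list \<Rightarrow> 'a list" where
  "reindex k \<sigma> ds = map (\<lambda>i. ds ! \<sigma> i) [0..<k]"

definition lc_pow :: "nat \<Rightarrow> ('x, 'd) lc \<Rightarrow> ('x list, 'd list) lc" where
  "lc_pow k \<D> =
     \<lparr> lc_vars = {xs. length xs = k \<and> set xs \<subseteq> lc_vars \<D>},
       lc_dom = (\<lambda>xs. listset (map (lc_dom \<D>) xs)),
       lc_constraints =
         {(map fst cs, prod_map (map (fst \<circ> snd) cs), map (snd \<circ> snd) cs) | cs.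
            length cs = k \<and> set cs \<subseteq> add_id_constraints \<D>} \<union>
         {(reindex k \<sigma> xs, reindex k \<sigma>, xs) | xs \<sigma>.
            length xs = k \<and> set xs \<subseteq> lc_vars \<D> \<and> \<sigma> \<in> {..<k} \<rightarrow> {..<k}} \<rparr>"


lemma mem_listset: "ds \<in> listset As \<longleftrightarrow> list_all2 (\<in>) ds As"
  by (induction As arbitrary: ds) (auto simp: set_Cons_def list_all2_Cons2)

lemma lc_instance_pow:
  fixes \<D> :: "('x, 'd) lc"
  assumes "lc_instance \<D>"
  shows "lc_instance (lc_pow k \<D>)"
proof -
  have fin: "finite (lc_vars \<D>)" "finite (add_id_constraints \<D>)"
    using assms by (auto simp: lc_instance_def add_id_constraints_def setcompr_eq_image)
  have con: "x \<in> lc_vars \<D> \<and> y \<in> lc_vars \<D> \<and> \<alpha> \<in> lc_dom \<D> y \<rightarrow> lc_dom \<D> x"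
    if "(x, \<alpha>, y) \<in> add_id_constraints \<D>" for x \<alpha> y
    using that assms by (auto simp: lc_instance_def add_id_constraints_def)
  have X: "finite {xs. length xs = k \<and> set xs \<subseteq> lc_vars \<D>}"
    using finite_lists_length_eq[OF fin(1), of k] by (simp add: conj_commute)
  have dom: "finite (listset (map (lc_dom \<D>) xs))" if "set xs \<subseteq> lc_vars \<D>" for xs
    using that
  proof (induction xs)
    case (Cons x xs)
    have "listset (map (lc_dom \<D>) (x # xs)) =
        (\<lambda>(a, as). a # as) ` (lc_dom \<D> x \<times> listset (map (lc_dom \<D>) xs))"
      by (auto simp: set_Cons_def)
    then show ?case using Cons assms by (simp add: lc_instance_def)
  qed simp
  have "finite {cs. length cs = k \<and> set cs \<subseteq> add_id_constraints \<D>}"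
    using finite_lists_length_eq[OF fin(2), of k] by (simp add: conj_commute)
  then have C1: "finite {(map fst cs, prod_map (map (fst \<circ> snd) cs), map (snd \<circ> snd) cs) | cs.
      length cs = k \<and> set cs \<subseteq> add_id_constraints \<D>}"
    by (simp add: setcompr_eq_image)
  have "{(reindex k \<sigma> xs, reindex k \<sigma> :: 'd list \<Rightarrow> 'd list, xs) | xs \<sigma>.
        length xs = k \<and> set xs \<subseteq> lc_vars \<D> \<and> \<sigma> \<in> {..<k} \<rightarrow> {..<k}}
      \<subseteq> (\<lambda>(xs, \<sigma>). (reindex k \<sigma> xs, reindex k \<sigma>, xs)) `
        ({xs. length xs = k \<and> set xs \<subseteq> lc_vars \<D>} \<times> ({..<k} \<rightarrow>\<^sub>E {..<k}))"
    (is "?L \<subseteq> ?R")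
  proof
    fix c assume "c \<in> ?L"
    then obtain xs \<sigma> where c: "c = (reindex k \<sigma> xs, reindex k \<sigma>, xs)"
      and xs: "length xs = k" "set xs \<subseteq> lc_vars \<D>" and \<sigma>: "\<sigma> \<in> {..<k} \<rightarrow> {..<k}"
      by blast
    define \<tau> where "\<tau> = restrict \<sigma> {..<k}"
    have 1: "reindex k \<sigma> = (reindex k \<tau> :: 'x list \<Rightarrow> 'x list)"
      and 2: "reindex k \<sigma> = (reindex k \<tau> :: 'd list \<Rightarrow> 'd list)"
      by (auto simp: reindex_def \<tau>_def)
    have "\<tau> \<in> {..<k} \<rightarrow>\<^sub>E {..<k}" using \<sigma> by (auto simp: \<tau>_def)
    then show "c \<in> ?R"
      using xs unfolding c 1 2 by (intro image_eqI[of _ _ "(xs, \<tau>)"]) auto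
  qed
  then have C2: "finite {(reindex k \<sigma> xs, reindex k \<sigma> :: 'd list \<Rightarrow> 'd list, xs) | xs \<sigma>.
        length xs = k \<and> set xs \<subseteq> lc_vars \<D> \<and> \<sigma> \<in> {..<k} \<rightarrow> {..<k}}"
    by (rule finite_subset) (intro finite_imageI finite_cartesian_product X finite_PiE, auto)
  have W1: "set (map fst cs) \<subseteq> lc_vars \<D> \<and> set (map (snd \<circ> snd) cs) \<subseteq> lc_vars \<D> \<and>
      prod_map (map (fst \<circ> snd) cs) \<in> listset (map (lc_dom \<D>) (map (snd \<circ> snd) cs)) \<rightarrow>
        listset (map (lc_dom \<D>) (map fst cs))"
    if "set cs \<subseteq> add_id_constraints \<D>" for cs
    using that
  proof (induction cs)
    case (Cons c cs)
    obtain x \<alpha> y where c: "c = (x, \<alpha>, y)" by (cases c)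
    show ?case using Cons con[of x \<alpha> y]
      by (auto simp: c prod_map_def set_Cons_def Pi_iff)
  qed (simp add: prod_map_def)
  have W2: "set (reindex k \<sigma> xs) \<subseteq> lc_vars \<D> \<and>
      reindex k \<sigma> \<in> listset (map (lc_dom \<D>) xs) \<rightarrow> listset (map (lc_dom \<D>) (reindex k \<sigma> xs))"
    if "length xs = k" "set xs \<subseteq> lc_vars \<D>" "\<sigma> \<in> {..<k} \<rightarrow> {..<k}" for xs \<sigma>
    using that by (fastforce simp: reindex_def mem_listset list_all2_conv_all_nth Pi_iff)
  have len: "length (reindex k \<sigma> xs) = k" for \<sigma> and xs :: "'x list"
    by (simp add: reindex_def)
  show ?thesis
    unfolding lc_instance_def lc_pow_def lc.select_convs ball_Un
  proof (intro conjI)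
    show "\<forall>xs\<in>{xs. length xs = k \<and> set xs \<subseteq> lc_vars \<D>}. finite (listset (map (lc_dom \<D>) xs))"
      using dom by blast
  qed (use X C1 C2 W1 W2 len in \<open>blast intro: finite_UnI length_map\<close>)+
qed


section \<open>The minion of affine maps modulo a prime\<close>

text \<open>The field \<open>\<int>\<^sub>p\<close> is the type \<open>'p mod_ring\<close>, where \<open>p = CARD('p)\<close> is prime because \<open>'p\<close> is of
  class \<open>prime_card\<close>. Functions with domain \<open>D\<close> are extensional, i.e. \<open>undefined\<close> outside \<open>D\<close>.\<close>

definition Z_minion :: "('d, 'd \<Rightarrow> 'p::prime_card mod_ring) minion" where
  "Z_minion =
     \<lparr> obj = (\<lambda>D. {f \<in> D \<rightarrow>\<^sub>E UNIV. (\<Sum>a\<in>D. f a) = 1}),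
       arr = (\<lambda>D E \<alpha> f. \<lambda>b\<in>E. \<Sum>a\<in>{a\<in>D. \<alpha> a = b}. f a) \<rparr>"


lemma sum_fibres:
  assumes "finite D" "finite E" "\<alpha> \<in> D \<rightarrow> E"
  shows "(\<Sum>b\<in>E. \<Sum>a\<in>{a\<in>D. \<alpha> a = b}. f a) = (\<Sum>a\<in>D. f a)"
  using sum.group[of D E \<alpha> f] assms by auto

lemma fibres_comp:
  assumes "finite D" "finite E" "\<alpha> \<in> D \<rightarrow> E"
  shows "(\<Sum>b\<in>{b\<in>E. \<beta> b = c}. \<Sum>a\<in>{a\<in>D. \<alpha> a = b}. f a) = (\<Sum>a\<in>{a\<in>D. \<beta> (\<alpha> a) = c}. f a)"
proof -
  have "(\<Sum>b\<in>{b\<in>E. \<beta> b = c}. \<Sum>a\<in>{a\<in>D. \<alpha> a = b}. f a)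
      = (\<Sum>b\<in>{b\<in>E. \<beta> b = c}. \<Sum>a\<in>{a\<in>{a\<in>D. \<beta> (\<alpha> a) = c}. \<alpha> a = b}. f a)"
    by (intro sum.cong refl) auto
  also have "\<dots> = (\<Sum>a\<in>{a\<in>D. \<beta> (\<alpha> a) = c}. f a)"
    by (rule sum_fibres) (use assms in auto)
  finally show ?thesis .
qed

lemma fibre_id: "a \<in> D \<Longrightarrow> {a'\<in>D. a' = a} = {a}"
  by auto

lemma is_minion_Z: "is_minion (Z_minion :: ('d, 'd \<Rightarrow> 'p::prime_card mod_ring) minion)"
  unfolding is_minion_def
proof (intro conjI allI impI)
  fix D E :: "'d set" and \<alpha> \<alpha>' :: "'d \<Rightarrow> 'd" and r :: "'d \<Rightarrow> 'p mod_ring"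
  assume "\<forall>a\<in>D. \<alpha> a = \<alpha>' a"
  then have "\<And>b. {a\<in>D. \<alpha> a = b} = {a\<in>D. \<alpha>' a = b}" by auto
  then show "arr Z_minion D E \<alpha> r = arr Z_minion D E \<alpha>' r"
    by (simp add: Z_minion_def)
next
  fix D E F :: "'d set" and \<alpha> \<beta> :: "'d \<Rightarrow> 'd" and r :: "'d \<Rightarrow> 'p mod_ring"
  assume *: "finite D" "finite E" "\<alpha> \<in> D \<rightarrow> E"
  have "(\<Sum>b\<in>{b\<in>E. \<beta> b = c}. (\<lambda>b\<in>E. \<Sum>a\<in>{a\<in>D. \<alpha> a = b}. r a) b)
      = (\<Sum>a\<in>{a\<in>D. \<beta> (\<alpha> a) = c}. r a)" for c
    unfolding fibres_comp[OF *, symmetric] by (intro sum.cong) auto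
  then show "arr Z_minion D F (\<beta> \<circ> \<alpha>) r = arr Z_minion E F \<beta> (arr Z_minion D E \<alpha> r)"
    by (simp add: Z_minion_def)
next
  fix D :: "'d set" and r :: "'d \<Rightarrow> 'p mod_ring"
  assume "r \<in> obj Z_minion D"
  then show "arr Z_minion D D id r = r"
    by (auto simp: Z_minion_def fibre_id restrict_def PiE_def extensional_def)
next
  fix D E :: "'d set" and \<alpha> :: "'d \<Rightarrow> 'd" and r :: "'d \<Rightarrow> 'p mod_ring"
  assume "finite D" "finite E" "\<alpha> \<in> D \<rightarrow> E" "r \<in> obj Z_minion D"
  then show "arr Z_minion D E \<alpha> r \<in> obj Z_minion E"
    by (simp add: Z_minion_def sum_fibres)
qed


section \<open>The vector minion modulo a prime\<close>

definition wsum :: "'a::comm_monoid_add vec \<Rightarrow> 'a" where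
  "wsum v = (\<Sum>j<dim_vec v. v $ j)"

definition cprod :: "'a::times vec \<Rightarrow> 'a vec \<Rightarrow> 'a vec" (infixl "\<odot>\<^sub>v" 70) where
  "u \<odot>\<^sub>v v = vec (dim_vec u) (\<lambda>j. u $ j * v $ j)"

text \<open>\<open>cprods u [u\<^sub>1, \<dots>, u\<^sub>m]\<close> is \<open>u \<odot>\<^sub>v u\<^sub>1 \<odot>\<^sub>v \<dots> \<odot>\<^sub>v u\<^sub>m\<close>.\<close>

definition cprods :: "'a::times vec \<Rightarrow> 'a vec list \<Rightarrow> 'a vec" where
  "cprods u us = foldl (\<odot>\<^sub>v) u us"

type_synonym ('d, 'p) vec_triple =
  "'p mod_ring vec set \<times> 'p mod_ring vec \<times> ('d \<Rightarrow> 'p mod_ring vec)"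

definition VZ_obj :: "nat \<Rightarrow> 'd set \<Rightarrow> ('d, 'p::prime_card) vec_triple set" where
  "VZ_obj k D = {(V, i, v). \<exists>N.
     VectorSpace.subspace class_ring V (module_vec TYPE('p mod_ring) N) \<and>
     i \<in> V \<and> v \<in> D \<rightarrow>\<^sub>E V \<and>
     i = vec N (\<lambda>_. 1) \<and> wsum i = 1 \<and>
     finsum_vec TYPE('p mod_ring) N v D = i \<and>
     (\<forall>a\<in>D. \<forall>b\<in>D. a \<noteq> b \<longrightarrow>
        (\<forall>us. length us = k - 2 \<and> set us \<subseteq> V \<longrightarrow> wsum (cprods (v a \<odot>\<^sub>v v b) us) = 0)) \<and>
     (\<forall>a\<in>D. \<forall>us. length us = k - 2 \<and> set us \<subseteq> V \<longrightarrow>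
        wsum (cprods (v a \<odot>\<^sub>v v a) us) = wsum (cprods (v a) us))}"

text \<open>The dimension \<open>N\<close> of the ambient space is that of the vector \<open>i\<close>.\<close>

definition VZ_arr ::
  "'d set \<Rightarrow> 'd set \<Rightarrow> ('d \<Rightarrow> 'd) \<Rightarrow> ('d, 'p::prime_card) vec_triple \<Rightarrow> ('d, 'p) vec_triple" where
  "VZ_arr D E \<alpha> = (\<lambda>(V, i, v).
     (V, i, \<lambda>b\<in>E. finsum_vec TYPE('p mod_ring) (dim_vec i) v {a\<in>D. \<alpha> a = b}))"

definition VZ_minion :: "nat \<Rightarrow> ('d, ('d, 'p::prime_card) vec_triple) minion" where
  "VZ_minion k = \<lparr> obj = VZ_obj k, arr = VZ_arr \<rparr>"

lemma wsum_cprods: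
  assumes "u \<in> carrier_vec N" "set us \<subseteq> carrier_vec N"
  shows "wsum (cprods u us) = (\<Sum>j<N. u $ j * (\<Prod>w\<leftarrow>us. w $ j :: 'a::comm_semiring_1))"
proof -
  have "cprods u us \<in> carrier_vec N \<and>
      (\<forall>j<N. cprods u us $ j = u $ j * (\<Prod>w\<leftarrow>us. w $ j))"
    using assms
  proof (induction us arbitrary: u)
    case Nil
    then show ?case by (simp add: cprods_def)
  next
    case (Cons w us)
    have "u \<odot>\<^sub>v w \<in> carrier_vec N" "set us \<subseteq> carrier_vec N"
      using Cons.prems by (auto simp: cprod_def)
    from Cons.IH[OF this] show ?case
      using Cons.prems by (auto simp: cprods_def cprod_def mult.assoc)
  qed
  then show ?thesis by (auto simp: wsum_def)
qed

lemma wsum_cprods2: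
  assumes "u \<in> carrier_vec N" "set us \<subseteq> carrier_vec N"
  shows "wsum (cprods (u \<odot>\<^sub>v v) us) = (\<Sum>j<N. u $ j * v $ j * (\<Prod>w\<leftarrow>us. w $ j :: 'a::comm_semiring_1))"
proof -
  have "u \<odot>\<^sub>v v \<in> carrier_vec N" using assms by (auto simp: cprod_def)
  from wsum_cprods[OF this assms(2)] show ?thesis
    using assms by (auto simp: cprod_def intro!: sum.cong)
qed

lemma subspace_carrier:
  assumes "VectorSpace.subspace class_ring V (module_vec TYPE('a::field) N)"
  shows "V \<subseteq> carrier_vec N"
  using assms by (auto simp: VectorSpace.subspace_def submodule_def module_vec_simps)

lemma subspace_finsum_vec:
  assumes V: "VectorSpace.subspace class_ring V (module_vec TYPE('a::field) N)"
    and fin: "finite A" and v: "v \<in> A \<rightarrow> V"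
  shows "finsum_vec TYPE('a) N v A \<in> V"
  using fin v
proof (induction A rule: finite_induct)
  case empty
  then show ?case using V
    by (auto simp: finsum_vec_empty VectorSpace.subspace_def submodule_def module_vec_simps)
next
  case (insert a A)
  have "v a \<in> carrier_vec N" "v \<in> A \<rightarrow> carrier_vec N"
    using insert.prems subspace_carrier[OF V] by auto
  then have "finsum_vec TYPE('a) N v (insert a A) = v a + finsum_vec TYPE('a) N v A"
    using insert.hyps by (intro finsum_vec_insert) auto
  then show ?case using insert V
    by (auto simp: VectorSpace.subspace_def submodule_def module_vec_simps)
qed

lemma finsum_vec_eq:
  assumes "finite A" "v \<in> A \<rightarrow> carrier_vec N"
  shows "finsum_vec TYPE('a::comm_monoid_add) N v A = vec N (\<lambda>j. \<Sum>a\<in>A. v a $ j)"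
  using index_finsum_vec[OF assms(1) _ assms(2)] finsum_vec_closed[OF assms(2)]
  by (intro eq_vecI) auto

lemma VZ_arr_closed:
  fixes r :: "('d, 'p::prime_card) vec_triple"
  assumes D: "finite D" and E: "finite E" and \<alpha>: "\<alpha> \<in> D \<rightarrow> E" and r: "r \<in> VZ_obj k D"
  shows "VZ_arr D E \<alpha> r \<in> VZ_obj k E"
proof -
  obtain V i v where r_eq: "r = (V, i, v)" by (cases r)
  define N where "N = dim_vec i"
  have V: "VectorSpace.subspace class_ring V (module_vec TYPE('p mod_ring) N)"
    and i: "i \<in> V" "i = vec N (\<lambda>_. 1)" "wsum i = 1"
    and v: "v \<in> D \<rightarrow>\<^sub>E V" and s: "finsum_vec TYPE('p mod_ring) N v D = i"
    and o: "\<And>a b us. a \<in> D \<Longrightarrow> b \<in> D \<Longrightarrow> a \<noteq> b \<Longrightarrow> length us = k - 2 \<Longrightarrow> set us \<subseteq> V \<Longrightarrow>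
      wsum (cprods (v a \<odot>\<^sub>v v b) us) = 0"
    and p: "\<And>a us. a \<in> D \<Longrightarrow> length us = k - 2 \<Longrightarrow> set us \<subseteq> V \<Longrightarrow>
      wsum (cprods (v a \<odot>\<^sub>v v a) us) = wsum (cprods (v a) us)"
    using r by (auto simp: VZ_obj_def r_eq N_def)
  have VN: "V \<subseteq> carrier_vec N" by (rule subspace_carrier[OF V])
  define v' where "v' b = finsum_vec TYPE('p mod_ring) N v {a\<in>D. \<alpha> a = b}" for b
  have v'V: "v' b \<in> V" for b
    unfolding v'_def using v D by (intro subspace_finsum_vec[OF V]) auto
  have v'_eq: "v' b = vec N (\<lambda>j. \<Sum>a\<in>{a\<in>D. \<alpha> a = b}. v a $ j)" for b
    unfolding v'_def using v D VN by (intro finsum_vec_eq) auto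
  have i_eq: "i = vec N (\<lambda>j. \<Sum>a\<in>D. v a $ j)"
    unfolding s[symmetric] using v D VN by (intro finsum_vec_eq) auto
  have s': "finsum_vec TYPE('p mod_ring) N (restrict v' E) E = i"
  proof -
    have "finsum_vec TYPE('p mod_ring) N (restrict v' E) E = vec N (\<lambda>j. \<Sum>b\<in>E. restrict v' E b $ j)"
      using v'V VN E by (intro finsum_vec_eq) auto
    also have "\<dots> = vec N (\<lambda>j. \<Sum>a\<in>D. v a $ j)"
      unfolding sum_fibres[OF D E \<alpha>, symmetric] by (intro eq_vecI) (auto simp: v'_eq)
    finally show ?thesis using i_eq by simp
  qed
  have bil: "wsum (cprods (v' b \<odot>\<^sub>v v' c) us) =
      (\<Sum>a\<in>{a\<in>D. \<alpha> a = b}. \<Sum>a'\<in>{a\<in>D. \<alpha> a = c}. wsum (cprods (v a \<odot>\<^sub>v v a') us))"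
    if us: "set us \<subseteq> V" for b c us
  proof -
    have us': "set us \<subseteq> carrier_vec N" using us VN by auto
    have vN: "a \<in> D \<Longrightarrow> v a \<in> carrier_vec N" for a using v VN by auto
    have "wsum (cprods (v' b \<odot>\<^sub>v v' c) us) =
      (\<Sum>j<N. (\<Sum>a\<in>{a\<in>D. \<alpha> a = b}. v a $ j) * (\<Sum>a\<in>{a\<in>D. \<alpha> a = c}. v a $ j) * (\<Prod>w\<leftarrow>us. w $ j))"
      using v'V[of b] VN us' by (subst wsum_cprods2[of _ N]) (auto simp: v'_eq)
    also have "\<dots> = (\<Sum>j<N. \<Sum>a\<in>{a\<in>D. \<alpha> a = b}. \<Sum>a'\<in>{a\<in>D. \<alpha> a = c}.
        v a $ j * v a' $ j * (\<Prod>w\<leftarrow>us. w $ j))"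
      by (intro sum.cong refl) (simp only: sum_product, simp only: sum_distrib_right)
    also have "\<dots> = (\<Sum>a\<in>{a\<in>D. \<alpha> a = b}. \<Sum>j<N. \<Sum>a'\<in>{a\<in>D. \<alpha> a = c}.
        v a $ j * v a' $ j * (\<Prod>w\<leftarrow>us. w $ j))"
      by (rule sum.swap)
    also have "\<dots> = (\<Sum>a\<in>{a\<in>D. \<alpha> a = b}. \<Sum>a'\<in>{a\<in>D. \<alpha> a = c}. \<Sum>j<N.
        v a $ j * v a' $ j * (\<Prod>w\<leftarrow>us. w $ j))"
      by (intro sum.cong refl sum.swap)
    also have "\<dots> = (\<Sum>a\<in>{a\<in>D. \<alpha> a = b}. \<Sum>a'\<in>{a\<in>D. \<alpha> a = c}. wsum (cprods (v a \<odot>\<^sub>v v a') us))"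
      by (intro sum.cong refl, subst wsum_cprods2[of _ N]) (auto simp: vN us')
    finally show ?thesis .
  qed
  have lin: "wsum (cprods (v' b) us) = (\<Sum>a\<in>{a\<in>D. \<alpha> a = b}. wsum (cprods (v a) us))"
    if us: "set us \<subseteq> V" for b us
  proof -
    have us': "set us \<subseteq> carrier_vec N" using us VN by auto
    have vN: "a \<in> D \<Longrightarrow> v a \<in> carrier_vec N" for a using v VN by auto
    have "wsum (cprods (v' b) us) = (\<Sum>j<N. (\<Sum>a\<in>{a\<in>D. \<alpha> a = b}. v a $ j) * (\<Prod>w\<leftarrow>us. w $ j))"
      using v'V[of b] VN us' by (subst wsum_cprods[of _ N]) (auto simp: v'_eq)
    also have "\<dots> = (\<Sum>a\<in>{a\<in>D. \<alpha> a = b}. \<Sum>j<N. v a $ j * (\<Prod>w\<leftarrow>us. w $ j))"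
      unfolding sum_distrib_right by (rule sum.swap)
    also have "\<dots> = (\<Sum>a\<in>{a\<in>D. \<alpha> a = b}. wsum (cprods (v a) us))"
      by (intro sum.cong refl, subst wsum_cprods[of _ N]) (auto simp: vN us')
    finally show ?thesis .
  qed
  have o': "wsum (cprods (v' b \<odot>\<^sub>v v' c) us) = 0"
    if "b \<noteq> c" "length us = k - 2" "set us \<subseteq> V" for b c us
    unfolding bil[OF that(3)] using that by (intro sum.neutral ballI o) auto
  have p': "wsum (cprods (v' b \<odot>\<^sub>v v' b) us) = wsum (cprods (v' b) us)"
    if "length us = k - 2" "set us \<subseteq> V" for b us
  proof -
    let ?A = "{a\<in>D. \<alpha> a = b}"
    have "(\<Sum>a'\<in>?A. wsum (cprods (v a \<odot>\<^sub>v v a') us)) = wsum (cprods (v a) us)" if "a \<in> ?A" for a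
    proof -
      have "(\<Sum>a'\<in>?A. wsum (cprods (v a \<odot>\<^sub>v v a') us)) =
          (\<Sum>a'\<in>?A. if a' = a then wsum (cprods (v a) us) else 0)"
        using that o p \<open>length us = k - 2\<close> \<open>set us \<subseteq> V\<close> by (intro sum.cong) auto
      then show ?thesis using that D by simp
    qed
    then show ?thesis unfolding bil[OF that(2)] lin[OF that(2)] by (intro sum.cong) auto
  qed
  have arr_eq: "VZ_arr D E \<alpha> r = (V, i, restrict v' E)"
    by (simp add: VZ_arr_def r_eq N_def[symmetric] v'_def[abs_def])
  have "restrict v' E \<in> E \<rightarrow>\<^sub>E V" using v'V by auto
  then show ?thesis
    unfolding arr_eq VZ_obj_def using V i s' o' p'
    by (simp del: restrict_PiE_iff) (rule exI[of _ N], auto)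
qed

lemma is_minion_VZ: "is_minion (VZ_minion k :: ('d, ('d, 'p::prime_card) vec_triple) minion)"
  unfolding is_minion_def
proof (intro conjI allI impI)
  fix D E :: "'d set" and \<alpha> \<alpha>' :: "'d \<Rightarrow> 'd" and r :: "('d, 'p) vec_triple"
  assume "\<forall>a\<in>D. \<alpha> a = \<alpha>' a"
  then have "\<And>b. {a\<in>D. \<alpha> a = b} = {a\<in>D. \<alpha>' a = b}" by auto
  then show "arr (VZ_minion k) D E \<alpha> r = arr (VZ_minion k) D E \<alpha>' r"
    by (simp add: VZ_minion_def VZ_arr_def)
next
  fix D E F :: "'d set" and \<alpha> \<beta> :: "'d \<Rightarrow> 'd" and r :: "('d, 'p) vec_triple"
  assume *: "finite D" "finite E" "\<alpha> \<in> D \<rightarrow> E" and r: "r \<in> obj (VZ_minion k) D"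
  obtain V i v where r_eq: "r = (V, i, v)" by (cases r)
  define N where "N = dim_vec i"
  have "VectorSpace.subspace class_ring V (module_vec TYPE('p mod_ring) N)" "v \<in> D \<rightarrow>\<^sub>E V"
    using r by (auto simp: VZ_obj_def VZ_minion_def r_eq N_def)
  with subspace_carrier have v: "v \<in> D \<rightarrow> carrier_vec N" by blast
  have v1: "finsum_vec TYPE('p mod_ring) N v {a\<in>D. P a} = vec N (\<lambda>j. \<Sum>a\<in>{a\<in>D. P a}. v a $ j)" for P
    using v * by (intro finsum_vec_eq) auto
  have "finsum_vec TYPE('p mod_ring) N
      (\<lambda>b\<in>E. finsum_vec TYPE('p mod_ring) N v {a\<in>D. \<alpha> a = b}) {b\<in>E. \<beta> b = c}
      = finsum_vec TYPE('p mod_ring) N v {a\<in>D. \<beta> (\<alpha> a) = c}" for c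
    unfolding v1 using *
    by (subst finsum_vec_eq) (auto simp: fibres_comp[OF *, symmetric] intro!: eq_vecI sum.cong)
  then show "arr (VZ_minion k) D F (\<beta> \<circ> \<alpha>) r = arr (VZ_minion k) E F \<beta> (arr (VZ_minion k) D E \<alpha> r)"
    by (simp add: VZ_minion_def VZ_arr_def r_eq N_def)
next
  fix D :: "'d set" and r :: "('d, 'p) vec_triple"
  assume r: "r \<in> obj (VZ_minion k) D"
  obtain V i v where r_eq: "r = (V, i, v)" by (cases r)
  define N where "N = dim_vec i"
  have "VectorSpace.subspace class_ring V (module_vec TYPE('p mod_ring) N)" and vE: "v \<in> D \<rightarrow>\<^sub>E V"
    using r by (auto simp: VZ_obj_def VZ_minion_def r_eq N_def)
  with subspace_carrier have v: "v \<in> D \<rightarrow> carrier_vec N" by blast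
  have "finsum_vec TYPE('p mod_ring) N v {a\<in>D. a = b} = v b" if b: "b \<in> D" for b
  proof -
    have "v b \<in> carrier_vec N" using v b by auto
    then show ?thesis unfolding fibre_id[OF b] by (subst finsum_vec_eq) auto
  qed
  then have "(\<lambda>b\<in>D. finsum_vec TYPE('p mod_ring) N v {a\<in>D. a = b}) = v"
    using vE by (intro ext) (simp add: PiE_def extensional_def restrict_def)
  then show "arr (VZ_minion k) D D id r = r"
    by (simp add: VZ_minion_def VZ_arr_def r_eq N_def)
next
  fix D E :: "'d set" and \<alpha> :: "'d \<Rightarrow> 'd" and r :: "('d, 'p) vec_triple"
  assume "finite D" "finite E" "\<alpha> \<in> D \<rightarrow> E" "r \<in> obj (VZ_minion k) D"
  then show "arr (VZ_minion k) D E \<alpha> r \<in> obj (VZ_minion k) E"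
    by (simp add: VZ_minion_def VZ_arr_closed)
qed

end

theory Submission
  imports Defs
begin

text \<open>Solvability on either side amounts to the existence of vectors \<open>u (x, a)\<close> in \<open>\<int>\<^sub>p\<^sup>N\<close>, one for each
  element \<open>a\<close> of the domain of a variable \<open>x\<close>, that satisfy the linear relations of the instance
  and for which the sum of the entries of a product of at most \<open>k\<close> of them (a moment) depends only
  on the set of factors and is \<open>0\<close> if two factors give different values to one variable. In a
  solution in the vector minion, connectedness puts the vectors of all variables into one space;
  conversely, one takes their span. The moments of degree \<open>k\<close> are a solution of the saturated power.
  A solution of the power is, by its reindexing constraints, a function \<open>g\<close> on the sets of at most
  \<open>k\<close> points \<open>(x, a)\<close>. Every function on the subsets of a finite set is a moment function of 0/1
  vectors, by inclusion-exclusion with multiplicities modulo \<open>p\<close>; applied to a basis of the points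
  modulo the linear relations of \<open>g\<close>, this gives the vectors.\<close>

section \<open>Realising set functions by products of vectors\<close>

lemma prod_list_indicator:
  "(\<Prod>a\<leftarrow>as. if a \<in> T then 1 else 0 :: 'r::comm_semiring_1) = (if set as \<subseteq> T then 1 else 0)"
  by (induction as) auto

lemma sum_list_nth: "(\<Sum>j<length xs. h (xs ! j)) = (\<Sum>x\<leftarrow>xs. h x :: 'r::comm_monoid_add)"
  by (simp add: sum_list_sum_nth atLeast0LessThan)

text \<open>Induction on \<open>B\<close>: for \<open>S\<close> avoiding \<open>b\<close>, sets
  containing \<open>b\<close> contribute equally to the counts at \<open>S\<close> and
  \<open>insert b S\<close>, while sets avoiding \<open>b\<close> contribute only to the count at
  \<open>S\<close>. Hence \<open>L\<^sub>1\<close> produces the values at sets with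
  \<open>b\<close>, and \<open>L\<^sub>0\<close> corrects the others by the difference. Any residue
  is attained because a set may be repeated in the list.\<close>

lemma superset_count_realise:
  fixes g :: "'a set \<Rightarrow> 'p::prime_card mod_ring"
  assumes "finite B"
  shows "\<exists>L. (\<forall>T\<in>set L. T \<subseteq> B) \<and> (\<forall>S\<subseteq>B. (\<Sum>T\<leftarrow>L. if S \<subseteq> T then 1 else 0) = g S)"
  using assms
proof (induction B arbitrary: g rule: finite_induct)
  case empty
  obtain n where "g {} = of_nat n" using surj_of_nat_mod_ring by blast
  then show ?case
    by (intro exI[of _ "replicate n {}"]) (auto simp: sum_list_replicate)
next
  case (insert b B)
  obtain L\<^sub>1 where L\<^sub>1: "\<forall>T\<in>set L\<^sub>1. T \<subseteq> B"
    "\<forall>S\<subseteq>B. (\<Sum>T\<leftarrow>L\<^sub>1. if S \<subseteq> T then 1 else 0) = g (insert b S)"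
    using insert.IH[of "\<lambda>S. g (insert b S)"] by (elim exE conjE)
  obtain L\<^sub>0 where L\<^sub>0: "\<forall>T\<in>set L\<^sub>0. T \<subseteq> B"
    "\<forall>S\<subseteq>B. (\<Sum>T\<leftarrow>L\<^sub>0. if S \<subseteq> T then 1 else 0) = g S - g (insert b S)"
    using insert.IH[of "\<lambda>S. g S - g (insert b S)"] by (elim exE conjE)
  let ?L = "L\<^sub>0 @ map (insert b) L\<^sub>1"
  have "(\<Sum>T\<leftarrow>?L. if S \<subseteq> T then 1 else 0) = g S" if S: "S \<subseteq> insert b B" for S
  proof -
    have 1: "(\<Sum>T\<leftarrow>map (insert b) L\<^sub>1. if S \<subseteq> T then 1 else 0) = g (insert b S)"
    proof -
      have "(\<Sum>T\<leftarrow>map (insert b) L\<^sub>1. if S \<subseteq> T then 1 else 0 :: 'p mod_ring)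
          = (\<Sum>T\<leftarrow>L\<^sub>1. if S - {b} \<subseteq> T then 1 else 0)"
        by (intro arg_cong[of _ _ sum_list]) (auto simp: subset_insert_iff)
      also have "\<dots> = g (insert b (S - {b}))" using S by (intro L\<^sub>1(2)[rule_format]) auto
      finally show ?thesis by simp
    qed
    have 0: "(\<Sum>T\<leftarrow>L\<^sub>0. if S \<subseteq> T then 1 else 0) = (if b \<in> S then 0 else g S - g (insert b S))"
    proof (cases "b \<in> S")
      case True
      then have "(\<Sum>T\<leftarrow>L\<^sub>0. if S \<subseteq> T then 1 else 0 :: 'p mod_ring) = (\<Sum>T\<leftarrow>L\<^sub>0. 0)"
        using L\<^sub>0(1) insert.hyps by (intro arg_cong[of _ _ sum_list] map_cong) auto
      then show ?thesis using True by simp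
    qed (use L\<^sub>0(2) S in \<open>simp add: subset_insert\<close>)
    show ?thesis using 0 1 by (auto simp: insert_absorb)
  qed
  moreover have "\<forall>T\<in>set ?L. T \<subseteq> insert b B" using L\<^sub>0(1) L\<^sub>1(1) by auto
  ultimately show ?case by (intro exI[of _ ?L]) simp
qed

lemma maximal_finite_subset:
  assumes "finite A" "P {}"
  obtains B where "B \<subseteq> A" "P B" "\<And>a. a \<in> A \<Longrightarrow> a \<notin> B \<Longrightarrow> \<not> P (insert a B)"
proof -
  let ?\<B> = "{B. B \<subseteq> A \<and> P B}"
  have "finite ?\<B>" "?\<B> \<noteq> {}" using assms by auto
  from finite_has_maximal[OF this] obtain B
    where B: "B \<in> ?\<B>" "\<forall>C\<in>?\<B>. B \<subseteq> C \<longrightarrow> B = C" by (elim bexE)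
  show ?thesis
  proof (rule that)
    show "\<not> P (insert a B)" if "a \<in> A" "a \<notin> B" for a
    proof
      assume "P (insert a B)"
      then have "insert a B \<in> ?\<B>" using B(1) that(1) by simp
      then have "B = insert a B" using B(2) by blast
      then show False using that(2) by blast
    qed
  qed (use B(1) in simp_all)
qed

section \<open>Vectors with prescribed moments\<close>

definition moment :: "nat \<Rightarrow> ('a \<Rightarrow> nat \<Rightarrow> 'r::comm_semiring_1) \<Rightarrow> 'a list \<Rightarrow> 'r" where
  "moment N u as = (\<Sum>j<N. \<Prod>a\<leftarrow>as. u a j)"

lemma moment_cong_mset: "mset as = mset bs \<Longrightarrow> moment N u as = moment N u bs"
  unfolding moment_def
  by (simp only: mset_map flip: prod_mset_prod_list)

text \<open>The values of \<open>g\<close> with one element inserted form, for each \<open>a\<close>, a vector indexed by the small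
  sets \<open>S\<close>. On a basis \<open>B\<close> of the span of these vectors together with \<open>g\<close> itself, the moments are
  matched by 0/1 vectors; the other elements are then forced by linearity.\<close>

lemma moments_realise_set_function:
  fixes g :: "'a set \<Rightarrow> 'p::prime_card mod_ring"
  assumes A: "finite A" and g0: "g {} = 1" and k: "k > 0"
  obtains N u where
    "\<And>as. set as \<subseteq> A \<Longrightarrow> length as \<le> k \<Longrightarrow> moment N u as = g (set as)"
    "\<And>c\<^sub>0 c j. (\<And>S. S \<subseteq> A \<Longrightarrow> card S < k \<Longrightarrow> c\<^sub>0 * g S + (\<Sum>a\<in>A. c a * g (insert a S)) = 0) \<Longrightarrow>
       j < N \<Longrightarrow> c\<^sub>0 + (\<Sum>a\<in>A. c a * u a j) = 0"
proof -
  define rel where "rel B c\<^sub>0 c \<longleftrightarrow>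
    (\<forall>S\<subseteq>A. card S < k \<longrightarrow> c\<^sub>0 * g S + (\<Sum>a\<in>B. c a * g (insert a S)) = 0)" for B c\<^sub>0 c
  define ind where "ind B \<longleftrightarrow> (\<forall>c\<^sub>0 c. rel B c\<^sub>0 c \<longrightarrow> c\<^sub>0 = 0 \<and> (\<forall>b\<in>B. c b = 0))" for B
  \<comment> \<open>\<open>g\<close> itself is a nonzero vector: its coordinate at the empty set is
    1, and the empty set is an admissible index because \<open>k > 0\<close>.\<close>
  have "ind {}"
    unfolding ind_def
  proof (intro allI impI conjI ballI)
    fix c\<^sub>0 c assume "rel {} c\<^sub>0 c"
    then have "c\<^sub>0 * g {} = 0" using k unfolding rel_def by (metis add.right_neutral card.empty empty_subsetI sum.empty)
    then show "c\<^sub>0 = 0" using g0 by simp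
  qed simp
  then obtain B where B: "B \<subseteq> A" "ind B" "\<And>a. a \<in> A \<Longrightarrow> a \<notin> B \<Longrightarrow> \<not> ind (insert a B)"
    using maximal_finite_subset[OF A] by blast
  have finB: "finite B" using B(1) A by (rule finite_subset)
  \<comment> \<open>Maximality of \<open>B\<close> yields a nontrivial relation for every
    \<open>a\<close> outside \<open>B\<close>. In it \<open>c a\<close> is nonzero, since otherwise
    \<open>B\<close> would be dependent, and one can solve for \<open>a\<close>.\<close>
  have "\<exists>e\<^sub>0 e. \<forall>S\<subseteq>A. card S < k \<longrightarrow> g (insert a S) = e\<^sub>0 * g S + (\<Sum>b\<in>B. e b * g (insert b S))"
    if a: "a \<in> A" for a
  proof (cases "a \<in> B")
    case True
    then show ?thesis using finB
      by (intro exI[of _ 0] exI[of _ "\<lambda>b. if b = a then 1 else 0"]) (simp add: if_distrib[of "\<lambda>x. x * _"] cong: if_cong)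
  next
    case False
    then obtain c\<^sub>0 c where c: "rel (insert a B) c\<^sub>0 c" "\<not> (c\<^sub>0 = 0 \<and> (\<forall>b\<in>insert a B. c b = 0))"
      using B(3)[OF a] by (auto simp: ind_def)
    have ca: "c a \<noteq> 0"
    proof
      assume "c a = 0"
      then have "rel B c\<^sub>0 c" using c(1) False finB by (simp add: rel_def)
      then show False using B(2) c(2) \<open>c a = 0\<close> by (auto simp: ind_def)
    qed
    have "g (insert a S) = (- c\<^sub>0 / c a) * g S + (\<Sum>b\<in>B. (- c b / c a) * g (insert b S))"
      if "S \<subseteq> A" "card S < k" for S
    proof -
      have "c\<^sub>0 * g S + (c a * g (insert a S) + (\<Sum>b\<in>B. c b * g (insert b S))) = 0"
        using c(1) that False finB by (simp add: rel_def)
      then have "c a * g (insert a S) = - c\<^sub>0 * g S - (\<Sum>b\<in>B. c b * g (insert b S))"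
        by (simp add: algebra_simps eq_neg_iff_add_eq_0)
      then have "g (insert a S) = (- c\<^sub>0 * g S - (\<Sum>b\<in>B. c b * g (insert b S))) / c a"
        using ca by (metis nonzero_mult_div_cancel_left)
      also have "\<dots> = (- c\<^sub>0 / c a) * g S + (\<Sum>b\<in>B. (- c b / c a) * g (insert b S))"
        by (simp add: diff_divide_distrib sum_divide_distrib sum_negf)
      finally show ?thesis .
    qed
    then show ?thesis by (intro exI[of _ "- c\<^sub>0 / c a"] exI[of _ "\<lambda>b. - c b / c a"]) blast
  qed
  then obtain e\<^sub>0 e where e: "\<And>a S. a \<in> A \<Longrightarrow> S \<subseteq> A \<Longrightarrow> card S < k \<Longrightarrow>
      g (insert a S) = e\<^sub>0 a * g S + (\<Sum>b\<in>B. e a b * g (insert b S))"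
    by metis
  \<comment> \<open>The coordinates of the new vectors are the members of \<open>L\<close>. Products
    of the indicators \<open>w b\<close> count supersets, so on basis elements the moments are
    already those of \<open>g\<close>.\<close>
  obtain L where L: "\<And>S. S \<subseteq> B \<Longrightarrow> (\<Sum>T\<leftarrow>L. if S \<subseteq> T then 1 else 0) = g S"
    using superset_count_realise[OF finB, of g] by blast
  define w :: "'a \<Rightarrow> nat \<Rightarrow> 'p mod_ring" where "w b j = (if b \<in> L ! j then 1 else 0)" for b j
  \<comment> \<open>The same coefficients that express \<open>a\<close> through \<open>g\<close> and
    the basis, with the all-ones vector in the place of \<open>g\<close>.\<close>
  define u where "u a j = e\<^sub>0 a + (\<Sum>b\<in>B. e a b * w b j)" for a j
  \<comment> \<open>Factors \<open>u a\<close> are expanded one at a time: each term drops the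
    factor or moves some \<open>b\<close> to \<open>bs\<close>, so the degree stays at most
    \<open>k\<close>. The equation \<open>e\<close> makes \<open>g\<close> expand in the same
    way.\<close>
  have mixed: "(\<Sum>j<length L. (\<Prod>b\<leftarrow>bs. w b j) * (\<Prod>a\<leftarrow>as. u a j)) = g (set bs \<union> set as)"
    if "set bs \<subseteq> B" "set as \<subseteq> A" "length bs + length as \<le> k" for bs as
    using that
  proof (induction as arbitrary: bs)
    case Nil
    have "(\<Sum>j<length L. \<Prod>b\<leftarrow>bs. w b j) = (\<Sum>j<length L. if set bs \<subseteq> L ! j then 1 else 0)"
      unfolding w_def prod_list_indicator ..
    also have "\<dots> = g (set bs)"
      unfolding sum_list_nth[of "\<lambda>T. if set bs \<subseteq> T then 1 else 0" L] using Nil by (intro L)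
    finally show ?case by simp
  next
    case (Cons a as)
    let ?S = "set bs \<union> set as"
    \<comment> \<open>The factor \<open>a\<close> takes one of the \<open>k\<close> places, so the
      remaining factors form a set of fewer than \<open>k\<close> points, as \<open>e\<close>
      requires.\<close>
    have "card ?S \<le> length (bs @ as)" using card_length[of "bs @ as"] by simp
    then have S: "?S \<subseteq> A" "card ?S < k" using Cons.prems B(1) by auto
    have "(\<Sum>j<length L. (\<Prod>b\<leftarrow>bs. w b j) * (\<Prod>a\<leftarrow>a # as. u a j))
        = e\<^sub>0 a * (\<Sum>j<length L. (\<Prod>b\<leftarrow>bs. w b j) * (\<Prod>a\<leftarrow>as. u a j))
          + (\<Sum>j<length L. \<Sum>b\<in>B. e a b * ((\<Prod>b\<leftarrow>b # bs. w b j) * (\<Prod>a\<leftarrow>as. u a j)))"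
      by (simp add: u_def[of a] algebra_simps sum.distrib sum_distrib_left)
    also have "(\<Sum>j<length L. \<Sum>b\<in>B. e a b * ((\<Prod>b\<leftarrow>b # bs. w b j) * (\<Prod>a\<leftarrow>as. u a j)))
        = (\<Sum>b\<in>B. e a b * (\<Sum>j<length L. (\<Prod>b\<leftarrow>b # bs. w b j) * (\<Prod>a\<leftarrow>as. u a j)))"
      unfolding sum_distrib_left by (rule sum.swap)
    also have "\<dots> = (\<Sum>b\<in>B. e a b * g (insert b ?S))"
      using Cons.prems by (intro sum.cong refl arg_cong2[of _ _ _ _ "(*)"], subst Cons.IH) auto
    also have "(\<Sum>j<length L. (\<Prod>b\<leftarrow>bs. w b j) * (\<Prod>a\<leftarrow>as. u a j)) = g ?S"
      using Cons.prems by (intro Cons.IH) auto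
    also have "e\<^sub>0 a * g ?S + (\<Sum>b\<in>B. e a b * g (insert b ?S)) = g (insert a ?S)"
      using Cons.prems S by (intro e[symmetric]) auto
    finally show ?case by simp
  qed
  show ?thesis
  proof (rule that[of "length L" u])
    show "moment (length L) u as = g (set as)" if "set as \<subseteq> A" "length as \<le> k" for as
      using mixed[of "[]" as] that by (simp add: moment_def)
    fix c\<^sub>0 c j
    assume c: "\<And>S. S \<subseteq> A \<Longrightarrow> card S < k \<Longrightarrow> c\<^sub>0 * g S + (\<Sum>a\<in>A. c a * g (insert a S)) = 0"
    \<comment> \<open>Turns a combination over \<open>A\<close> into one over the basis. It is
      applied to the values of \<open>g\<close> and, with \<open>z = 1\<close>, to the entries of
      the vectors.\<close>
    have swap: "(\<Sum>a\<in>A. c a * (e\<^sub>0 a * z + (\<Sum>b\<in>B. e a b * h b)))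
        = (\<Sum>a\<in>A. c a * e\<^sub>0 a) * z + (\<Sum>b\<in>B. (\<Sum>a\<in>A. c a * e a b) * h b)" for z h
    proof -
      have "(\<Sum>b\<in>B. (\<Sum>a\<in>A. c a * e a b) * h b) = (\<Sum>a\<in>A. \<Sum>b\<in>B. c a * e a b * h b)"
        unfolding sum_distrib_right by (rule sum.swap)
      then show ?thesis
        by (simp add: algebra_simps sum.distrib sum_distrib_left sum_distrib_right)
    qed
    \<comment> \<open>Rewritten over the basis, the given relation is one between independent
      vectors, so all its coefficients vanish. The same coefficients appear when the
      \<open>u a j\<close> are expanded.\<close>
    have "rel B (c\<^sub>0 + (\<Sum>a\<in>A. c a * e\<^sub>0 a)) (\<lambda>b. \<Sum>a\<in>A. c a * e a b)"
      unfolding rel_def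
    proof (intro allI impI)
      fix S assume S: "S \<subseteq> A" "card S < k"
      have eq: "(\<Sum>a\<in>A. c a * g (insert a S))
          = (\<Sum>a\<in>A. c a * (e\<^sub>0 a * g S + (\<Sum>b\<in>B. e a b * g (insert b S))))"
        using S by (intro sum.cong refl arg_cong2[of _ _ _ _ "(*)"] e)
      then show "(c\<^sub>0 + (\<Sum>a\<in>A. c a * e\<^sub>0 a)) * g S + (\<Sum>b\<in>B. (\<Sum>a\<in>A. c a * e a b) * g (insert b S)) = 0"
        using c[OF S] unfolding eq swap by (simp add: distrib_right add.assoc)
    qed
    then have z: "c\<^sub>0 + (\<Sum>a\<in>A. c a * e\<^sub>0 a) = 0" "\<And>b. b \<in> B \<Longrightarrow> (\<Sum>a\<in>A. c a * e a b) = 0"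
      using B(2) by (auto simp: ind_def)
    have "(\<Sum>a\<in>A. c a * u a j) = (\<Sum>a\<in>A. c a * (e\<^sub>0 a * 1 + (\<Sum>b\<in>B. e a b * w b j)))"
      by (simp add: u_def)
    then show "c\<^sub>0 + (\<Sum>a\<in>A. c a * u a j) = 0"
      unfolding swap using z by simp
  qed
qed

section \<open>Systems of vectors with set-like moments\<close>

abbreviation lc_points :: "('x, 'd) lc \<Rightarrow> ('x \<times> 'd) set" where
  "lc_points \<D> \<equiv> Sigma (lc_vars \<D>) (lc_dom \<D>)"

lemma finite_lc_points: "lc_instance \<D> \<Longrightarrow> finite (lc_points \<D>)"
  by (auto simp: lc_instance_def)

text \<open>The first clause is the condition \<open>wsum i = 1\<close> of the vector minion and
  fixes the moment of the empty list. The last two are the forms that (p) and (o) take for products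
  of at most \<open>k\<close> of the vectors.\<close>

definition vector_system ::
  "nat \<Rightarrow> ('x, 'd) lc \<Rightarrow> nat \<Rightarrow> ('x \<times> 'd \<Rightarrow> nat \<Rightarrow> 'r::comm_ring_1) \<Rightarrow> bool" where
  "vector_system k \<D> N u \<longleftrightarrow>
     of_nat N = (1 :: 'r) \<and>
     (\<forall>x\<in>lc_vars \<D>. \<forall>j<N. (\<Sum>a\<in>lc_dom \<D> x. u (x, a) j) = 1) \<and>
     (\<forall>(x, \<alpha>, y)\<in>lc_constraints \<D>. \<forall>b\<in>lc_dom \<D> x. \<forall>j<N.
        u (x, b) j = (\<Sum>a\<in>{a\<in>lc_dom \<D> y. \<alpha> a = b}. u (y, a) j)) \<and>
     (\<forall>as bs. set as \<subseteq> lc_points \<D> \<longrightarrow> set as = set bs \<longrightarrow> length as \<le> k \<longrightarrow> length bs \<le> k \<longrightarrow>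
        moment N u as = moment N u bs) \<and>
     (\<forall>as x a b. set as \<subseteq> lc_points \<D> \<longrightarrow> length as \<le> k \<longrightarrow> (x, a) \<in> set as \<longrightarrow> (x, b) \<in> set as \<longrightarrow>
        a \<noteq> b \<longrightarrow> moment N u as = 0)"

lemma
  assumes "vector_system k \<D> N (u :: 'x \<times> 'd \<Rightarrow> nat \<Rightarrow> 'r::comm_ring_1)"
  shows vector_system_dim: "of_nat N = (1 :: 'r)"
    and vector_system_sum: "x \<in> lc_vars \<D> \<Longrightarrow> j < N \<Longrightarrow> (\<Sum>a\<in>lc_dom \<D> x. u (x, a) j) = 1"
    and vector_system_constraint: "(x, \<alpha>, y) \<in> lc_constraints \<D> \<Longrightarrow> b \<in> lc_dom \<D> x \<Longrightarrow> j < N \<Longrightarrow>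
        u (x, b) j = (\<Sum>a\<in>{a\<in>lc_dom \<D> y. \<alpha> a = b}. u (y, a) j)"
    and vector_system_cong: "set as \<subseteq> lc_points \<D> \<Longrightarrow> set as = set bs \<Longrightarrow> length as \<le> k \<Longrightarrow>
        length bs \<le> k \<Longrightarrow> moment N u as = moment N u bs"
    and vector_system_conflict: "set as \<subseteq> lc_points \<D> \<Longrightarrow> length as \<le> k \<Longrightarrow> (x, a) \<in> set as \<Longrightarrow>
        (x, b) \<in> set as \<Longrightarrow> a \<noteq> b \<Longrightarrow> moment N u as = 0"
  using assms unfolding vector_system_def by blast+

section \<open>Vector systems and the vector minion\<close>

definition vec_span :: "nat \<Rightarrow> 'a set \<Rightarrow> ('a \<Rightarrow> nat \<Rightarrow> 'r::field) \<Rightarrow> 'r vec set" where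
  "vec_span N A u = range (\<lambda>c. vec N (\<lambda>j. \<Sum>a\<in>A. c a * u a j))"

lemma subspace_vec_span:
  "VectorSpace.subspace class_ring (vec_span N A u) (module_vec TYPE('r::field) N)"
proof -
  interpret V: vectorspace class_ring "module_vec TYPE('r) N" by (rule vec_vs)
  have "\<exists>c. v + w = vec N (\<lambda>j. \<Sum>a\<in>A. c a * u a j)"
    if "v = vec N (\<lambda>j. \<Sum>a\<in>A. c a * u a j)" "w = vec N (\<lambda>j. \<Sum>a\<in>A. d a * u a j)" for v w c d
    using that by (intro exI[of _ "\<lambda>a. c a + d a"]) (auto simp: distrib_right sum.distrib intro!: eq_vecI)
  moreover have "\<exists>d. t \<cdot>\<^sub>v v = vec N (\<lambda>j. \<Sum>a\<in>A. d a * u a j)"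
    if "v = vec N (\<lambda>j. \<Sum>a\<in>A. c a * u a j)" for v c and t :: 'r
    using that by (intro exI[of _ "\<lambda>a. t * c a"]) (auto simp: mult.assoc sum_distrib_left intro!: eq_vecI)
  moreover have "\<exists>c. 0\<^sub>v N = vec N (\<lambda>j. \<Sum>a\<in>A. c a * u a j)"
    by (intro exI[of _ "\<lambda>_. 0"]) (auto intro!: eq_vecI)
  ultimately show ?thesis
    unfolding VectorSpace.subspace_def submodule_def
    by (auto simp: vec_span_def module_vec_simps class_ring_simps image_iff V.vectorspace_axioms V.module_axioms)
qed

lemma vec_in_span:
  assumes "finite A" "a \<in> A"
  shows "vec N (u a) \<in> vec_span N A u"
  unfolding vec_span_def
  by (rule image_eqI[of _ _ "\<lambda>b. if b = a then 1 else 0"])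
    (use assms in \<open>auto simp: if_distrib[of "\<lambda>x. x * _"] cong: if_cong intro!: eq_vecI\<close>)

text \<open>Multilinearity: vanishing on products of generators carries over to products of elements
  of the span. The weight \<open>h\<close> varies in the induction because it absorbs each expanded
  factor.\<close>

lemma weighted_sum_span:
  assumes "finite A" "set us \<subseteq> vec_span N A u"
    and "\<And>as. set as \<subseteq> A \<Longrightarrow> length as = length us \<Longrightarrow> (\<Sum>j<N. h j * (\<Prod>a\<leftarrow>as. u a j)) = 0"
  shows "(\<Sum>j<N. h j * (\<Prod>w\<leftarrow>us. w $ j)) = 0"
  using assms(2,3)
proof (induction us arbitrary: h)
  case Nil
  from Nil(2)[of "[]"] show ?case by simp
next
  case (Cons w us)
  obtain c where w: "w = vec N (\<lambda>j. \<Sum>a\<in>A. c a * u a j)"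
    using Cons.prems(1) by (auto simp: vec_span_def)
  have "(\<Sum>j<N. h j * (\<Prod>w\<leftarrow>w # us. w $ j)) = (\<Sum>j<N. \<Sum>a\<in>A. c a * (h j * u a j * (\<Prod>w\<leftarrow>us. w $ j)))"
    by (intro sum.cong refl) (auto simp: w sum_distrib_left sum_distrib_right mult_ac)
  also have "\<dots> = (\<Sum>a\<in>A. c a * (\<Sum>j<N. h j * u a j * (\<Prod>w\<leftarrow>us. w $ j)))"
    unfolding sum_distrib_left by (rule sum.swap)
  also have "\<dots> = 0"
  proof (intro sum.neutral ballI)
    fix a assume a: "a \<in> A"
    have "(\<Sum>j<N. h j * u a j * (\<Prod>w\<leftarrow>us. w $ j)) = 0"
    proof (rule Cons.IH)
      show "(\<Sum>j<N. h j * u a j * (\<Prod>a\<leftarrow>as. u a j)) = 0" if "set as \<subseteq> A" "length as = length us" for as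
        using Cons.prems(2)[of "a # as"] a that by (simp add: mult.assoc)
    qed (use Cons.prems in auto)
    then show "c a * (\<Sum>j<N. h j * u a j * (\<Prod>w\<leftarrow>us. w $ j)) = 0" by simp
  qed
  finally show ?case .
qed

text \<open>The span of all vectors is the space of every variable. For fixed \<open>a\<close> and
  \<open>b\<close>, conditions (o) and (p) are multilinear in the other factors, so it suffices to
  check them on generators, where they concern moments of degree at most \<open>k\<close>.\<close>

lemma VZ_solution_of_vector_system:
  fixes u :: "'x \<times> 'd \<Rightarrow> nat \<Rightarrow> 'p::prime_card mod_ring"
  assumes k: "k \<ge> 2" and inst: "lc_instance \<D>" and u: "vector_system k \<D> N u"
  shows "has_solution (VZ_minion k :: ('d, ('d, 'p) vec_triple) minion) \<D>"
proof -
  let ?A = "lc_points \<D>"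
  define V where "V = vec_span N ?A u"
  define i :: "'p mod_ring vec" where "i = vec N (\<lambda>_. 1)"
  define v where "v x = (\<lambda>a\<in>lc_dom \<D> x. vec N (u (x, a)))" for x
  have finA: "finite ?A" by (rule finite_lc_points[OF inst])
  have fin: "finite (lc_dom \<D> x)" if "x \<in> lc_vars \<D>" for x
    using inst that by (simp add: lc_instance_def)
  have V: "VectorSpace.subspace class_ring V (module_vec TYPE('p mod_ring) N)"
    unfolding V_def by (rule subspace_vec_span)
  have VN: "V \<subseteq> carrier_vec N" by (auto simp: V_def vec_span_def)
  have v: "v x \<in> lc_dom \<D> x \<rightarrow>\<^sub>E V" if "x \<in> lc_vars \<D>" for x
    using that vec_in_span[OF finA] by (auto simp: v_def V_def)
  have s: "finsum_vec TYPE('p mod_ring) N (v x) (lc_dom \<D> x) = i" if x: "x \<in> lc_vars \<D>" for x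
    using fin[OF x] vector_system_sum[OF u x]
    by (subst finsum_vec_eq) (auto simp: v_def i_def intro!: eq_vecI)
  \<comment> \<open>The all-ones vector lies in the span as the sum of the vectors of one
    variable.\<close>
  have i: "i \<in> V" if x: "x \<in> lc_vars \<D>" for x
    using subspace_finsum_vec[OF V fin[OF x], of "v x"] v[OF x] s[OF x] by auto
  have obj: "(V, i, v x) \<in> VZ_obj k (lc_dom \<D> x)" if x: "x \<in> lc_vars \<D>" for x
  proof -
    have prod: "wsum (cprods (v x a \<odot>\<^sub>v v x b) us) = (\<Sum>j<N. u (x, a) j * u (x, b) j * (\<Prod>w\<leftarrow>us. w $ j))"
      if "a \<in> lc_dom \<D> x" "b \<in> lc_dom \<D> x" "set us \<subseteq> V" for a b us
      using that VN by (subst wsum_cprods2[of _ N]) (auto simp: v_def)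
    have single: "wsum (cprods (v x a) us) = (\<Sum>j<N. u (x, a) j * (\<Prod>w\<leftarrow>us. w $ j))"
      if "a \<in> lc_dom \<D> x" "set us \<subseteq> V" for a us
      using that VN by (subst wsum_cprods[of _ N]) (auto simp: v_def)
    have o: "wsum (cprods (v x a \<odot>\<^sub>v v x b) us) = 0"
      if ab: "a \<in> lc_dom \<D> x" "b \<in> lc_dom \<D> x" "a \<noteq> b" and us: "length us = k - 2" "set us \<subseteq> V" for a b us
    proof -
      \<comment> \<open>Together with the two conflicting points, the \<open>k - 2\<close>
        generators give a moment of degree exactly \<open>k\<close>.\<close>
      have "(\<Sum>j<N. u (x, a) j * u (x, b) j * (\<Prod>c\<leftarrow>as. u c j)) = 0"
        if "set as \<subseteq> ?A" "length as = length us" for as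
      proof -
        have "moment N u ((x, a) # (x, b) # as) = 0"
          by (rule vector_system_conflict[OF u, of _ x a b]) (use that ab us x k in auto)
        then show ?thesis by (simp add: moment_def mult.assoc)
      qed
      then show ?thesis unfolding prod[OF ab(1,2) us(2)]
        by (intro weighted_sum_span[OF finA us(2)[unfolded V_def]])
    qed
    have p: "wsum (cprods (v x a \<odot>\<^sub>v v x a) us) = wsum (cprods (v x a) us)"
      if a: "a \<in> lc_dom \<D> x" and us: "length us = k - 2" "set us \<subseteq> V" for a us
    proof -
      \<comment> \<open>Condition (p) is written as the vanishing of a single weighted sum, so that
        it extends to the span in the same way as (o).\<close>
      have "(\<Sum>j<N. (u (x, a) j * u (x, a) j - u (x, a) j) * (\<Prod>c\<leftarrow>as. u c j)) = 0"
        if "set as \<subseteq> ?A" "length as = length us" for as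
      proof -
        have "moment N u ((x, a) # (x, a) # as) = moment N u ((x, a) # as)"
          by (rule vector_system_cong[OF u]) (use that a us x k in auto)
        then show ?thesis by (simp add: moment_def left_diff_distrib sum_subtractf mult.assoc)
      qed
      then have "(\<Sum>j<N. (u (x, a) j * u (x, a) j - u (x, a) j) * (\<Prod>w\<leftarrow>us. w $ j)) = 0"
        by (intro weighted_sum_span[OF finA us(2)[unfolded V_def]])
      then show ?thesis unfolding prod[OF a a us(2)] single[OF a us(2)]
        by (simp add: left_diff_distrib sum_subtractf)
    qed
    have "wsum i = 1" using vector_system_dim[OF u] by (simp add: i_def wsum_def)
    then show ?thesis unfolding VZ_obj_def using V i[OF x] v[OF x] s[OF x] o p
      by (auto simp: i_def intro!: exI[of _ N])
  qed
  have arr: "v x = (\<lambda>b\<in>lc_dom \<D> x. finsum_vec TYPE('p mod_ring) (dim_vec i) (v y) {a\<in>lc_dom \<D> y. \<alpha> a = b})"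
    if c: "(x, \<alpha>, y) \<in> lc_constraints \<D>" for x \<alpha> y
  proof -
    have y: "y \<in> lc_vars \<D>" using c inst by (auto simp: lc_instance_def)
    have "vec N (u (x, b)) = finsum_vec TYPE('p mod_ring) N (v y) {a\<in>lc_dom \<D> y. \<alpha> a = b}"
      if "b \<in> lc_dom \<D> x" for b
      using fin[OF y] vector_system_constraint[OF u c that]
      by (subst finsum_vec_eq) (auto simp: v_def intro!: eq_vecI sum.cong)
    then show ?thesis by (auto simp: v_def[of x] i_def)
  qed
  have "lc_solution (VZ_minion k) \<D> (\<lambda>x. (V, i, v x))"
    unfolding lc_solution_def VZ_minion_def VZ_arr_def minion.select_convs
    using obj arr by fastforce
  then show ?thesis unfolding has_solution_def by blast
qed

section \<open>From a solution in the vector minion to a vector system\<close>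

lemma mem_obtain_mset:
  assumes "a \<in> set as"
  obtains bs where "mset as = mset (a # bs)"
proof -
  obtain ps qs where "as = ps @ a # qs" using split_list[OF assms] by blast
  then show thesis by (intro that[of "ps @ qs"]) simp
qed

text \<open>Conditions (o) and (p) speak of exactly \<open>k - 2\<close> further factors. Copies of
  the all-ones vector, which lies in \<open>V\<close>, fill up shorter products without changing
  them.\<close>

lemma pad_span_list:
  assumes "set as \<subseteq> A" "length as \<le> m"
    and v: "\<And>a. a \<in> A \<Longrightarrow> v a \<in> V" and i: "vec N (\<lambda>_. 1) \<in> V"
  obtains us where "length us = m" "set us \<subseteq> V"
    "\<And>j. j < N \<Longrightarrow> (\<Prod>w\<leftarrow>us. w $ j) = (\<Prod>a\<leftarrow>as. v a $ j :: 'r::comm_monoid_mult)"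
  by (rule that[of "map v as @ replicate (m - length as) (vec N (\<lambda>_. 1))"])
    (use assms in \<open>auto simp: comp_def prod_list_replicate\<close>)

text \<open>A repeated head is merged with its second copy by \<open>idem\<close>; any other head is
  set aside in \<open>bs\<close>, which is why the statement carries this second list.\<close>

lemma moment_remdups:
  assumes idem: "\<And>a as. a \<in> A \<Longrightarrow> set as \<subseteq> A \<Longrightarrow> length as + 2 \<le> k \<Longrightarrow>
      moment N u (a # a # as) = moment N u (a # as)"
    and "set as \<union> set bs \<subseteq> A" "length as + length bs \<le> k"
  shows "moment N u (as @ bs) = moment N u (remdups as @ bs)"
  using assms(2,3)
proof (induction as arbitrary: bs)
  case (Cons a as)
  show ?case
  proof (cases "a \<in> set as")
    case True
    then obtain as' where as': "mset as = mset (a # as')" by (rule mem_obtain_mset)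
    then have set': "set as = insert a (set as')" and len': "length as = Suc (length as')"
      using mset_eq_setD[OF as'] mset_eq_length[OF as'] by simp_all
    have "moment N u ((a # as) @ bs) = moment N u (a # a # as' @ bs)"
      using as' by (intro moment_cong_mset) simp
    also have "\<dots> = moment N u (a # as' @ bs)"
      using Cons.prems set' len' by (intro idem) auto
    also have "\<dots> = moment N u (as @ bs)"
      using as' by (intro moment_cong_mset) simp
    also have "\<dots> = moment N u (remdups as @ bs)"
      using Cons.prems by (intro Cons.IH) auto
    finally show ?thesis using True by simp
  next
    case False
    have "moment N u ((a # as) @ bs) = moment N u (as @ a # bs)"
      by (intro moment_cong_mset) simp
    also have "\<dots> = moment N u (remdups as @ a # bs)"
      using Cons.prems by (intro Cons.IH) auto
    also have "\<dots> = moment N u (remdups (a # as) @ bs)"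
      using False by (intro moment_cong_mset) simp
    finally show ?thesis .
  qed
qed simp

lemma moment_cong_set:
  assumes idem: "\<And>a as. a \<in> A \<Longrightarrow> set as \<subseteq> A \<Longrightarrow> length as + 2 \<le> k \<Longrightarrow>
      moment N u (a # a # as) = moment N u (a # as)"
    and "set as \<subseteq> A" "set as = set bs" "length as \<le> k" "length bs \<le> k"
  shows "moment N u as = moment N u bs"
proof -
  have "moment N u as = moment N u (remdups as)" "moment N u bs = moment N u (remdups bs)"
    using moment_remdups[OF idem, where bs = "[]"] assms by auto
  moreover have "moment N u (remdups as) = moment N u (remdups bs)"
    using assms(3) by (intro moment_cong_mset) (simp add: set_eq_iff_mset_remdups_eq[symmetric])
  ultimately show ?thesis by simp
qed

text \<open>The maps of the vector minion change only the family of vectors, so the space and the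
  all-ones vector agree along each edge, and by connectedness everywhere.\<close>

lemma VZ_solution_common_space:
  assumes "lc_connected \<D>" and sol: "lc_solution (VZ_minion k) \<D> r"
    and "x \<in> lc_vars \<D>" "y \<in> lc_vars \<D>"
  shows "fst (r x) = fst (r y) \<and> fst (snd (r x)) = fst (snd (r y))"
proof -
  have edge: "fst (r x) = fst (r y) \<and> fst (snd (r x)) = fst (snd (r y))"
    if "(x, y) \<in> lc_edges \<D>" for x y
    using sol that
    by (fastforce simp: lc_edges_def lc_solution_def VZ_minion_def VZ_arr_def split: prod.splits)
  have "(x, y) \<in> (lc_edges \<D> \<union> (lc_edges \<D>)\<inverse>)\<^sup>*"
    using assms by (simp add: lc_connected_def)
  then show ?thesis
    by (induction rule: rtrancl_induct) (use edge in fastforce)+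
qed

lemma vector_system_of_VZ_solution:
  fixes \<D> :: "('x, 'd) lc"
  assumes k: "k \<ge> 2" and inst: "lc_instance \<D>" and con: "lc_connected \<D>"
    and sol: "has_solution (VZ_minion k :: ('d, ('d, 'p::prime_card) vec_triple) minion) \<D>"
  shows "\<exists>N (u :: 'x \<times> 'd \<Rightarrow> nat \<Rightarrow> 'p mod_ring). vector_system k \<D> N u"
proof (cases "lc_vars \<D> = {}")
  \<comment> \<open>Without variables there is no space to read off. The only list of points is then
    empty, and \<open>N = 1\<close> gives it moment 1.\<close>
  case True
  then have "lc_constraints \<D> = {}" using inst by (fastforce simp: lc_instance_def)
  then have "vector_system k \<D> 1 (\<lambda>_ _. 0 :: 'p mod_ring)"
    using True by (simp add: vector_system_def)
  then show ?thesis by blast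
next
  case False
  then obtain x\<^sub>0 where x\<^sub>0: "x\<^sub>0 \<in> lc_vars \<D>" by blast
  obtain r :: "'x \<Rightarrow> ('d, 'p) vec_triple" where r: "lc_solution (VZ_minion k) \<D> r"
    using sol by (auto simp: has_solution_def)
  let ?A = "lc_points \<D>"
  define V where "V = fst (r x\<^sub>0)"
  define i where "i = fst (snd (r x\<^sub>0))"
  define N where "N = dim_vec i"
  define v where "v x = snd (snd (r x))" for x
  define u where "u = (\<lambda>(x, a) j. v x a $ j)"
  have r_eq: "r x = (V, i, v x)" if "x \<in> lc_vars \<D>" for x
    using VZ_solution_common_space[OF con r that x\<^sub>0]
    by (simp add: V_def i_def v_def prod_eq_iff)
  have fin: "finite (lc_dom \<D> x)" if "x \<in> lc_vars \<D>" for x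
    using inst that by (simp add: lc_instance_def)
  have obj: "(V, i, v x) \<in> VZ_obj k (lc_dom \<D> x)" if "x \<in> lc_vars \<D>" for x
    using r r_eq[OF that] that by (force simp: lc_solution_def VZ_minion_def)
  have V: "VectorSpace.subspace class_ring V (module_vec TYPE('p mod_ring) N)"
    and i: "i \<in> V" "i = vec N (\<lambda>_. 1)" "wsum i = 1"
    using obj[OF x\<^sub>0] by (auto simp: VZ_obj_def N_def)
  have VN: "V \<subseteq> carrier_vec N" by (rule subspace_carrier[OF V])
  have v: "v x \<in> lc_dom \<D> x \<rightarrow>\<^sub>E V"
    and s: "finsum_vec TYPE('p mod_ring) N (v x) (lc_dom \<D> x) = i"
    and o: "\<And>a b us. a \<in> lc_dom \<D> x \<Longrightarrow> b \<in> lc_dom \<D> x \<Longrightarrow> a \<noteq> b \<Longrightarrow> length us = k - 2 \<Longrightarrow>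
      set us \<subseteq> V \<Longrightarrow> wsum (cprods (v x a \<odot>\<^sub>v v x b) us) = 0"
    and p: "\<And>a us. a \<in> lc_dom \<D> x \<Longrightarrow> length us = k - 2 \<Longrightarrow> set us \<subseteq> V \<Longrightarrow>
      wsum (cprods (v x a \<odot>\<^sub>v v x a) us) = wsum (cprods (v x a) us)"
    if "x \<in> lc_vars \<D>" for x
    using obj[OF that] by (auto simp: VZ_obj_def N_def)
  have vV: "v x a \<in> V" if "x \<in> lc_vars \<D>" "a \<in> lc_dom \<D> x" for x a
    using v[OF that(1)] that(2) by auto
  have pad: "\<exists>us. length us = k - 2 \<and> set us \<subseteq> V \<and> (\<forall>j<N. (\<Prod>w\<leftarrow>us. w $ j) = (\<Prod>a\<leftarrow>as. u a j))"
    if "set as \<subseteq> ?A" "length as + 2 \<le> k" for as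
    by (rule pad_span_list[of as ?A "k - 2" "\<lambda>(x, a). v x a" V N])
      (use that vV i in \<open>auto simp: u_def case_prod_beta\<close>)
  \<comment> \<open>\<open>dist\<close> and \<open>idem\<close> are (o) and (p) for the vectors of
    the solution, brought by padding to all degrees up to \<open>k\<close>.\<close>
  have dist: "moment N u ((x, a) # (x, b) # as) = 0"
    if x: "x \<in> lc_vars \<D>" and ab: "a \<in> lc_dom \<D> x" "b \<in> lc_dom \<D> x" "a \<noteq> b"
      and as: "set as \<subseteq> ?A" "length as + 2 \<le> k" for x a b as
  proof -
    obtain us where us: "length us = k - 2" "set us \<subseteq> V" "\<And>j. j < N \<Longrightarrow> (\<Prod>w\<leftarrow>us. w $ j) = (\<Prod>a\<leftarrow>as. u a j)"
      using pad[OF as] by blast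
    have "moment N u ((x, a) # (x, b) # as) = wsum (cprods (v x a \<odot>\<^sub>v v x b) us)"
      using vV[OF x ab(1)] VN us(2,3)
      by (subst wsum_cprods2[of _ N]) (auto simp: moment_def u_def mult.assoc)
    then show ?thesis using o[OF x ab us(1,2)] by simp
  qed
  have idem: "moment N u ((x, a) # (x, a) # as) = moment N u ((x, a) # as)"
    if x: "x \<in> lc_vars \<D>" and a: "a \<in> lc_dom \<D> x" and as: "set as \<subseteq> ?A" "length as + 2 \<le> k" for x a as
  proof -
    obtain us where us: "length us = k - 2" "set us \<subseteq> V" "\<And>j. j < N \<Longrightarrow> (\<Prod>w\<leftarrow>us. w $ j) = (\<Prod>a\<leftarrow>as. u a j)"
      using pad[OF as] by blast
    have "moment N u ((x, a) # (x, a) # as) = wsum (cprods (v x a \<odot>\<^sub>v v x a) us)"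
      using vV[OF x a] VN us(2,3)
      by (subst wsum_cprods2[of _ N]) (auto simp: moment_def u_def mult.assoc)
    also have "\<dots> = wsum (cprods (v x a) us)" using p[OF x a us(1,2)] .
    also have "\<dots> = moment N u ((x, a) # as)"
      using vV[OF x a] VN us(2,3)
      by (subst wsum_cprods[of _ N]) (auto simp: moment_def u_def)
    finally show ?thesis .
  qed
  have "vector_system k \<D> N u"
    unfolding vector_system_def
  proof (intro conjI ballI allI impI, goal_cases)
    case 1
    show ?case using i by (simp add: wsum_def)
  next
    case (2 x j)
    have "(\<Sum>a\<in>lc_dom \<D> x. v x a $ j) = finsum_vec TYPE('p mod_ring) N (v x) (lc_dom \<D> x) $ j"
      using 2 fin vV VN by (subst finsum_vec_eq) auto
    then show ?case using 2 s i(2) by (simp add: u_def)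
  next
    case (3 c)
    obtain x \<alpha> y where c: "c = (x, \<alpha>, y)" by (cases c)
    have xy: "x \<in> lc_vars \<D>" "y \<in> lc_vars \<D>" using 3 inst c by (auto simp: lc_instance_def)
    have "r x = VZ_arr (lc_dom \<D> y) (lc_dom \<D> x) \<alpha> (r y)"
      using r 3 c by (auto simp: lc_solution_def VZ_minion_def)
    then have "v x = (\<lambda>b\<in>lc_dom \<D> x. finsum_vec TYPE('p mod_ring) N (v y) {a\<in>lc_dom \<D> y. \<alpha> a = b})"
      by (simp add: r_eq[OF xy(1)] r_eq[OF xy(2)] VZ_arr_def N_def)
    then have "v x b $ j = (\<Sum>a\<in>{a\<in>lc_dom \<D> y. \<alpha> a = b}. v y a $ j)" if "b \<in> lc_dom \<D> x" "j < N" for b j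
      using that fin[OF xy(2)] vV[OF xy(2)] VN by (simp, subst finsum_vec_eq) auto
    then show ?case by (simp add: c u_def)
  next
    case (4 as bs)
    show ?case by (rule moment_cong_set[of ?A k]) (use 4 idem in auto)
  next
    case (5 as x a b)
    obtain cs where cs: "mset as = mset ((x, a) # cs)" using mem_obtain_mset[OF 5(3)] .
    then have "(x, b) \<in> set cs" using 5(4,5) mset_eq_setD[OF cs] by auto
    then obtain ds where "mset cs = mset ((x, b) # ds)" by (rule mem_obtain_mset)
    with cs have m: "mset as = mset ((x, a) # (x, b) # ds)" by simp
    then have "moment N u as = moment N u ((x, a) # (x, b) # ds)" by (rule moment_cong_mset)
    also have "\<dots> = 0"
      using 5 mset_eq_setD[OF m] mset_eq_length[OF m] by (intro dist) auto
    finally show ?case .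
  qed
  then show ?thesis by blast
qed

section \<open>Vector systems and the saturated power\<close>

lemma mem_listset_nth:
  "ds \<in> listset (map D xs) \<longleftrightarrow> length ds = length xs \<and> (\<forall>i<length xs. ds ! i \<in> D (xs ! i))"
  by (auto simp: mem_listset list_all2_conv_all_nth)

lemma sum_prod_lists:
  fixes h :: "nat \<Rightarrow> 'd \<Rightarrow> 'r::comm_semiring_1"
  assumes "\<And>i. i < n \<Longrightarrow> finite (B i)"
  shows "(\<Sum>ds | length ds = n \<and> (\<forall>i<n. ds ! i \<in> B i). \<Prod>i<n. h i (ds ! i)) = (\<Prod>i<n. \<Sum>d\<in>B i. h i d)"
proof -
  have "(\<Prod>i<n. \<Sum>d\<in>B i. h i d) = (\<Sum>g\<in>Pi\<^sub>E {..<n} B. \<Prod>i<n. h i (g i))"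
    using assms by (intro prod_sum_PiE) auto
  also have "\<dots> = (\<Sum>ds | length ds = n \<and> (\<forall>i<n. ds ! i \<in> B i). \<Prod>i<n. h i (ds ! i))"
    by (rule sum.reindex_bij_witness[of _ "\<lambda>ds. restrict ((!) ds) {..<n}" "\<lambda>g. map g [0..<n]"])
      (auto simp: PiE_iff extensional_def intro!: nth_equalityI)
  finally show ?thesis by simp
qed

lemma moment_nth: "moment N u as = (\<Sum>j<N. \<Prod>i<length as. u (as ! i) j)"
  by (simp add: moment_def prod.list_conv_set_nth atLeast0LessThan)

lemma moment_zip:
  "length xs = k \<Longrightarrow> length ds = k \<Longrightarrow> moment N u (zip xs ds) = (\<Sum>j<N. \<Prod>i<k. u (xs ! i, ds ! i) j)"
  by (simp add: moment_nth)

lemma zip_subset_lc_points: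
  assumes "set xs \<subseteq> lc_vars \<D>" "ds \<in> listset (map (lc_dom \<D>) xs)"
  shows "set (zip xs ds) \<subseteq> lc_points \<D>"
  using assms by (auto simp: set_zip mem_listset_nth)

text \<open>For both kinds of constraints, the fibre of a tuple is a box, that is, a product of
  subsets of the domains. Over a box the sum of the degree \<open>k\<close> moments factors, at each
  entry \<open>j\<close>, into sums over single coordinates, to which the linear relations of the
  system apply.\<close>

lemma pow_solution_of_vector_system:
  fixes u :: "'x \<times> 'd \<Rightarrow> nat \<Rightarrow> 'p::prime_card mod_ring"
  assumes inst: "lc_instance \<D>" and u: "vector_system k \<D> N u"
  shows "has_solution (Z_minion :: ('d list, 'd list \<Rightarrow> 'p mod_ring) minion) (lc_pow k \<D>)"
proof -
  let ?D = "\<lambda>xs. listset (map (lc_dom \<D>) xs)"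
  define f where "f xs = (\<lambda>ds\<in>?D xs. moment N u (zip xs ds))" for xs
  have fin: "finite (lc_dom \<D> x)" if "x \<in> lc_vars \<D>" for x
    using inst that by (simp add: lc_instance_def)
  have sum_f: "(\<Sum>ds\<in>X. f xs ds) = (\<Sum>j<N. \<Prod>i<k. \<Sum>d\<in>B i. u (xs ! i, d) j)"
    if xs: "length xs = k" "set xs \<subseteq> lc_vars \<D>"
      and X: "X = {ds. length ds = k \<and> (\<forall>i<k. ds ! i \<in> B i)}"
      and B: "\<And>i. i < k \<Longrightarrow> B i \<subseteq> lc_dom \<D> (xs ! i)" for xs X B
  proof -
    have "finite (B i)" if "i < k" for i
      using B[OF that] fin xs that by (meson finite_subset nth_mem subsetD)
    then have "(\<Sum>j<N. \<Prod>i<k. \<Sum>d\<in>B i. u (xs ! i, d) j) = (\<Sum>j<N. \<Sum>ds\<in>X. \<Prod>i<k. u (xs ! i, ds ! i) j)"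
      unfolding X by (intro sum.cong refl sum_prod_lists[symmetric]) auto
    also have "\<dots> = (\<Sum>ds\<in>X. \<Sum>j<N. \<Prod>i<k. u (xs ! i, ds ! i) j)" by (rule sum.swap)
    also have "\<dots> = (\<Sum>ds\<in>X. f xs ds)"
    proof (intro sum.cong refl)
      fix ds assume "ds \<in> X"
      then have "length ds = k" "ds \<in> ?D xs" using B xs by (auto simp: X mem_listset_nth)
      then show "(\<Sum>j<N. \<Prod>i<k. u (xs ! i, ds ! i) j) = f xs ds"
        using xs by (simp add: f_def moment_zip)
    qed
    finally show ?thesis by simp
  qed
  have obj: "f xs \<in> obj Z_minion (?D xs)" if xs: "length xs = k" "set xs \<subseteq> lc_vars \<D>" for xs
  proof -
    have "xs ! i \<in> lc_vars \<D>" if "i < k" for i using xs that by auto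
    then have "(\<Prod>i<k. \<Sum>d\<in>lc_dom \<D> (xs ! i). u (xs ! i, d) j) = 1" if "j < N" for j
      using that by (intro prod.neutral) (auto simp: vector_system_sum[OF u])
    moreover have "?D xs = {ds. length ds = k \<and> (\<forall>i<k. ds ! i \<in> lc_dom \<D> (xs ! i))}"
      using xs by (auto simp: mem_listset_nth)
    ultimately have "(\<Sum>ds\<in>?D xs. f xs ds) = 1"
      by (simp add: sum_f[OF xs] vector_system_dim[OF u])
    then show ?thesis by (simp add: Z_minion_def f_def)
  qed
  have con: "u (x, b) j = (\<Sum>a\<in>{a\<in>lc_dom \<D> y. \<alpha> a = b}. u (y, a) j)"
    if "(x, \<alpha>, y) \<in> add_id_constraints \<D>" "b \<in> lc_dom \<D> x" "j < N" for x \<alpha> y b j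
    using that by (auto simp: add_id_constraints_def vector_system_constraint[OF u] fibre_id)
  have arr1: "f (map fst cs) = arr Z_minion (?D (map (snd \<circ> snd) cs)) (?D (map fst cs))
      (prod_map (map (fst \<circ> snd) cs)) (f (map (snd \<circ> snd) cs))"
    if cs: "length cs = k" "set cs \<subseteq> add_id_constraints \<D>" for cs
  proof -
    let ?xs = "map fst cs" and ?ys = "map (snd \<circ> snd) cs" and ?\<alpha> = "\<lambda>i. fst (snd (cs ! i))"
    have c: "(?xs ! i, ?\<alpha> i, ?ys ! i) \<in> add_id_constraints \<D>" if "i < k" for i
      using that cs nth_mem[of i cs] by auto
    have ys: "set ?ys \<subseteq> lc_vars \<D>"
      using cs inst by (fastforce simp: add_id_constraints_def lc_instance_def)
    have "f ?xs bs = (\<Sum>as\<in>{as\<in>?D ?ys. prod_map (map (fst \<circ> snd) cs) as = bs}. f ?ys as)"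
      if bs: "bs \<in> ?D ?xs" for bs
    proof -
      let ?B = "\<lambda>i. {a\<in>lc_dom \<D> (?ys ! i). ?\<alpha> i a = bs ! i}"
      have len: "length bs = k" using bs cs by (simp add: mem_listset_nth)
      have "{as\<in>?D ?ys. prod_map (map (fst \<circ> snd) cs) as = bs} =
          {as. length as = k \<and> (\<forall>i<k. as ! i \<in> ?B i)}"
        using cs len by (auto simp: mem_listset_nth prod_map_def list_eq_iff_nth_eq)
      from sum_f[OF _ ys this]
      have "(\<Sum>as\<in>{as\<in>?D ?ys. prod_map (map (fst \<circ> snd) cs) as = bs}. f ?ys as)
          = (\<Sum>j<N. \<Prod>i<k. \<Sum>a\<in>?B i. u (?ys ! i, a) j)"
        using cs by simp
      also have "\<dots> = (\<Sum>j<N. \<Prod>i<k. u (?xs ! i, bs ! i) j)"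
        using bs cs by (intro sum.cong prod.cong refl con[OF c, symmetric]) (auto simp: mem_listset_nth)
      also have "\<dots> = f ?xs bs"
        using bs cs len by (simp add: f_def moment_zip)
      finally show ?thesis by simp
    qed
    then show ?thesis
      by (auto simp: Z_minion_def f_def[of ?xs] restrict_def)
  qed
  have arr2: "f (reindex k \<sigma> xs) = arr Z_minion (?D xs) (?D (reindex k \<sigma> xs)) (reindex k \<sigma>) (f xs)"
    if xs: "length xs = k" "set xs \<subseteq> lc_vars \<D>" and \<sigma>: "\<sigma> \<in> {..<k} \<rightarrow> {..<k}" for xs \<sigma>
  proof -
    let ?ys = "reindex k \<sigma> xs"
    have ys: "length ?ys = k" "set ?ys \<subseteq> lc_vars \<D>"
      using xs \<sigma> by (auto simp: reindex_def Pi_iff intro!: subsetD[OF xs(2)])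
    have "f ?ys bs = (\<Sum>as\<in>{as\<in>?D xs. reindex k \<sigma> as = bs}. f xs as)" if bs: "bs \<in> ?D ?ys" for bs
    proof -
      \<comment> \<open>The positions sent to \<open>l\<close> all prescribe the value at
        \<open>l\<close>; at a position outside the image of \<open>\<sigma>\<close> the value is
        free.\<close>
      let ?B = "\<lambda>l. {a\<in>lc_dom \<D> (xs ! l). \<forall>i<k. \<sigma> i = l \<longrightarrow> bs ! i = a}"
      have len: "length bs = k" using bs ys by (simp add: mem_listset_nth)
      have bs_dom: "bs ! i \<in> lc_dom \<D> (xs ! \<sigma> i)" if "i < k" for i
        using bs that by (auto simp: mem_listset_nth reindex_def)
      have fys: "f ?ys bs = moment N u (zip ?ys bs)" using bs by (simp add: f_def)
      have zip_nth: "zip ?ys bs ! i = (xs ! \<sigma> i, bs ! i)" if "i < k" for i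
        using that len ys by (simp add: reindex_def)
      have points: "set (zip ?ys bs) \<subseteq> lc_points \<D>" by (rule zip_subset_lc_points[OF ys(2) bs])
      have "{as\<in>?D xs. reindex k \<sigma> as = bs} = {as. length as = k \<and> (\<forall>l<k. as ! l \<in> ?B l)}"
      proof (intro Set.set_eqI iffI)
        fix as assume "as \<in> {as\<in>?D xs. reindex k \<sigma> as = bs}"
        then show "as \<in> {as. length as = k \<and> (\<forall>l<k. as ! l \<in> ?B l)}"
          using xs by (auto simp: mem_listset_nth reindex_def)
      next
        fix as assume as: "as \<in> {as. length as = k \<and> (\<forall>l<k. as ! l \<in> ?B l)}"
        then have "bs ! i = as ! \<sigma> i" if "i < k" for i using that \<sigma> by fastforce
        then have "reindex k \<sigma> as = bs"
          using len by (simp add: reindex_def list_eq_iff_nth_eq)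
        then show "as \<in> {as\<in>?D xs. reindex k \<sigma> as = bs}"
          using as xs by (simp add: mem_listset_nth)
      qed
      from sum_f[OF xs this]
      have sum: "(\<Sum>as\<in>{as\<in>?D xs. reindex k \<sigma> as = bs}. f xs as)
          = (\<Sum>j<N. \<Prod>l<k. \<Sum>a\<in>?B l. u (xs ! l, a) j)"
        by simp
      show ?thesis
      \<comment> \<open>If two positions prescribe different values for the same \<open>l\<close>,
        the fibre is empty, and the moment on the left vanishes because its factors
        conflict.\<close>
      proof (cases "\<exists>i<k. \<exists>i'<k. \<sigma> i = \<sigma> i' \<and> bs ! i \<noteq> bs ! i'")
        case True
        then obtain i i' where i: "i < k" "i' < k" "\<sigma> i = \<sigma> i'" "bs ! i \<noteq> bs ! i'" by blast
        then have empty: "?B (\<sigma> i) = {}" by auto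
        have zero: "(\<Sum>a\<in>?B (\<sigma> i). u (xs ! \<sigma> i, a) j) = 0" for j
          unfolding empty by (rule sum.empty)
        have "(\<Prod>l<k. \<Sum>a\<in>?B l. u (xs ! l, a) j) = 0" for j
          by (rule prod_zero[OF finite_lessThan], rule bexI[of _ "\<sigma> i"], rule zero) (use i \<sigma> in auto)
        moreover have "(xs ! \<sigma> i, bs ! i) \<in> set (zip ?ys bs)" "(xs ! \<sigma> i, bs ! i') \<in> set (zip ?ys bs)"
          using zip_nth[of i] zip_nth[of i'] i len ys(1)
          by (metis length_zip min.idem nth_mem)+
        then have "moment N u (zip ?ys bs) = 0"
          by (intro vector_system_conflict[OF u points _ _ _ i(4)]) (use len in auto)
        ultimately show ?thesis unfolding sum fys by simp
      next
        case False
        \<comment> \<open>The prescribed value at \<open>l\<close>. The choice of the position is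
          immaterial because all positions sent to \<open>l\<close> agree.\<close>
        define c where "c l = bs ! (SOME i. i < k \<and> \<sigma> i = l)" for l
        have c: "c (\<sigma> i) = bs ! i" if "i < k" for i
        proof -
          let ?i = "SOME i'. i' < k \<and> \<sigma> i' = \<sigma> i"
          have "?i < k \<and> \<sigma> ?i = \<sigma> i" by (rule someI_ex) (use that in blast)
          then have "bs ! ?i = bs ! i" using False that by blast
          then show ?thesis by (simp add: c_def)
        qed
        let ?ls = "remdups (map \<sigma> [0..<k])"
        \<comment> \<open>Moments depend only on the set of factors, so each \<open>l\<close> in the
          image of \<open>\<sigma>\<close> can be made to contribute a single factor.\<close>
        have "moment N u (zip ?ys bs) = moment N u (map (\<lambda>l. (xs ! l, c l)) ?ls)"
        proof (rule vector_system_cong[OF u points])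
          have "zip ?ys bs = map (\<lambda>i. (xs ! \<sigma> i, c (\<sigma> i))) [0..<k]"
            by (intro nth_equalityI) (use zip_nth len ys(1) c in simp_all)
          then show "set (zip ?ys bs) = set (map (\<lambda>l. (xs ! l, c l)) ?ls)"
            by (simp add: image_image)
          show "length (map (\<lambda>l. (xs ! l, c l)) ?ls) \<le> k"
            using length_remdups_leq[of "map \<sigma> [0..<k]"] by simp
        qed (simp add: len)
        also have "\<dots> = (\<Sum>j<N. \<Prod>l\<in>\<sigma> ` {..<k}. u (xs ! l, c l) j)"
          by (simp add: moment_def comp_def prod.distinct_set_conv_list[symmetric] atLeast0LessThan)
        also have "\<dots> = (\<Sum>j<N. \<Prod>l<k. \<Sum>a\<in>?B l. u (xs ! l, a) j)"
        \<comment> \<open>The free positions can be added to the product: each contributes a sum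
          over its whole domain, which is 1.\<close>
        proof (intro sum.cong refl prod.mono_neutral_cong_left)
          fix j assume j: "j \<in> {..<N}"
          show "\<sigma> ` {..<k} \<subseteq> {..<k}" using \<sigma> by auto
          show "\<forall>l\<in>{..<k} - \<sigma> ` {..<k}. (\<Sum>a\<in>?B l. u (xs ! l, a) j) = 1"
          proof
            fix l assume l: "l \<in> {..<k} - \<sigma> ` {..<k}"
            then have B: "?B l = lc_dom \<D> (xs ! l)" by auto
            have "xs ! l \<in> lc_vars \<D>" using l xs by auto
            then show "(\<Sum>a\<in>?B l. u (xs ! l, a) j) = 1"
              unfolding B using vector_system_sum[OF u] j by simp
          qed
          show "u (xs ! l, c l) j = (\<Sum>a\<in>?B l. u (xs ! l, a) j)" if l: "l \<in> \<sigma> ` {..<k}" for l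
          proof -
            have B: "?B l = {c l}" using l c bs_dom by fastforce
            show ?thesis unfolding B by simp
          qed
        qed simp
        finally show ?thesis unfolding sum fys .
      qed
    qed
    then show ?thesis
      by (auto simp: Z_minion_def f_def[of ?ys] restrict_def)
  qed
  have "lc_solution Z_minion (lc_pow k \<D>) f"
    unfolding lc_solution_def lc_pow_def lc.select_convs ball_Un
    using obj arr1 arr2 by blast
  then show ?thesis unfolding has_solution_def by blast
qed

section \<open>From a solution of the saturated power to a vector system\<close>

lemma finite_set_as_list:
  assumes "finite S" "S \<noteq> {}" "card S \<le> m"
  obtains as where "set as = S" "length as = m"
proof -
  obtain as where as: "set as = S" "distinct as" using finite_distinct_list[OF assms(1)] by blast
  obtain a where "a \<in> S" using assms(2) by blast
  then show thesis
    using as assms(3) distinct_card[OF as(2)]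
    by (intro that[of "as @ replicate (m - length as) a"]) (auto simp: set_replicate_conv_if)
qed

text \<open>Overwriting position 0 by position 1 forgets the head without changing the length. The
  corresponding constraint therefore sums out one coordinate.\<close>

lemma reindex_dup_head:
  assumes "k = Suc (length ys)" "ys \<noteq> []"
  shows "reindex k (\<lambda>i. if i = 0 then 1 else i) (y # ys) = hd ys # ys"
  using assms by (simp add: reindex_def map_upt_Suc hd_conv_nth map_nth del: upt_Suc)

lemma sum_point:
  assumes "\<And>t. t \<in> T \<Longrightarrow> t \<noteq> s \<Longrightarrow> h t = 0" "finite T" "s \<in> T"
  shows "sum h T = h s"
  using assms by (subst sum.mono_neutral_right[of T "{s}"]) auto

lemma sum_indicator_mult:
  assumes "finite A" "B \<subseteq> A"
  shows "(\<Sum>a\<in>A. (if a \<in> B then 1 else 0) * h a) = (\<Sum>a\<in>B. h a :: 'r::semiring_1)"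
  using assms by (intro sum.mono_neutral_cong_right) auto

text \<open>By reindexing, \<open>f\<close> has the same value on all \<open>k\<close>-tuples that
  enumerate the same set of points, and this value is \<open>g\<close>. The marginal and constraint
  equations come from constraints that alter one coordinate and keep the points of \<open>S\<close>
  in the others.\<close>

lemma set_function_of_pow_solution:
  fixes \<D> :: "('x, 'd) lc"
  assumes k: "k \<ge> 2" and inst: "lc_instance \<D>"
    and sol: "has_solution (Z_minion :: ('d list, 'd list \<Rightarrow> 'p::prime_card mod_ring) minion) (lc_pow k \<D>)"
  obtains g :: "('x \<times> 'd) set \<Rightarrow> 'p::prime_card mod_ring" where
    "g {} = 1"
    "\<And>S x a b. S \<subseteq> lc_points \<D> \<Longrightarrow> card S \<le> k \<Longrightarrow> (x, a) \<in> S \<Longrightarrow> (x, b) \<in> S \<Longrightarrow> a \<noteq> b \<Longrightarrow> g S = 0"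
    "\<And>S x. S \<subseteq> lc_points \<D> \<Longrightarrow> card S < k \<Longrightarrow> x \<in> lc_vars \<D> \<Longrightarrow>
       (\<Sum>a\<in>lc_dom \<D> x. g (insert (x, a) S)) = g S"
    "\<And>S x \<alpha> y b. S \<subseteq> lc_points \<D> \<Longrightarrow> card S < k \<Longrightarrow> (x, \<alpha>, y) \<in> lc_constraints \<D> \<Longrightarrow>
       b \<in> lc_dom \<D> x \<Longrightarrow> g (insert (x, b) S) = (\<Sum>a\<in>{a\<in>lc_dom \<D> y. \<alpha> a = b}. g (insert (y, a) S))"
proof -
  let ?A = "lc_points \<D>" and ?D = "\<lambda>xs. listset (map (lc_dom \<D>) xs)"
  obtain f where f: "lc_solution (Z_minion :: ('d list, 'd list \<Rightarrow> 'p mod_ring) minion) (lc_pow k \<D>) f"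
    using sol by (auto simp: has_solution_def)
  have finA: "finite ?A" by (rule finite_lc_points[OF inst])
  have finS: "finite S" if "S \<subseteq> ?A" for S using that finA by (rule finite_subset)
  have fin: "finite (lc_dom \<D> x)" if "x \<in> lc_vars \<D>" for x
    using inst that by (simp add: lc_instance_def)
  have finD: "finite (?D xs)" if "length xs = k" "set xs \<subseteq> lc_vars \<D>" for xs
    using lc_instance_pow[OF inst, of k] that by (simp add: lc_instance_def lc_pow_def)
  have total: "(\<Sum>ds\<in>?D xs. f xs ds) = 1" if "length xs = k" "set xs \<subseteq> lc_vars \<D>" for xs
    using f that by (simp add: lc_solution_def lc_pow_def Z_minion_def)
  have prod_con: "f (map fst cs) bs
      = (\<Sum>as\<in>{as\<in>?D (map (snd \<circ> snd) cs). prod_map (map (fst \<circ> snd) cs) as = bs}. f (map (snd \<circ> snd) cs) as)"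
    if "length cs = k" "set cs \<subseteq> add_id_constraints \<D>" "bs \<in> ?D (map fst cs)" for cs bs
  proof -
    have "(map fst cs, prod_map (map (fst \<circ> snd) cs), map (snd \<circ> snd) cs) \<in> lc_constraints (lc_pow k \<D>)"
      unfolding lc_pow_def lc.select_convs using that by blast
    with f have "f (map fst cs) = arr Z_minion (?D (map (snd \<circ> snd) cs)) (?D (map fst cs))
        (prod_map (map (fst \<circ> snd) cs)) (f (map (snd \<circ> snd) cs))"
      unfolding lc_solution_def by (fastforce simp: lc_pow_def)
    then show ?thesis using that(3) by (simp only: Z_minion_def minion.select_convs restrict_apply if_True)
  qed
  have reindex_con: "f (reindex k \<sigma> xs) bs = (\<Sum>as\<in>{as\<in>?D xs. reindex k \<sigma> as = bs}. f xs as)"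
    if "length xs = k" "set xs \<subseteq> lc_vars \<D>" "\<sigma> \<in> {..<k} \<rightarrow> {..<k}" "bs \<in> ?D (reindex k \<sigma> xs)" for xs \<sigma> bs
  proof -
    have "(reindex k \<sigma> xs, reindex k \<sigma>, xs) \<in> lc_constraints (lc_pow k \<D>)"
      unfolding lc_pow_def lc.select_convs using that by blast
    with f have "f (reindex k \<sigma> xs) = arr Z_minion (?D xs) (?D (reindex k \<sigma> xs)) (reindex k \<sigma>) (f xs)"
      unfolding lc_solution_def by (fastforce simp: lc_pow_def)
    then show ?thesis using that(4) by (simp only: Z_minion_def minion.select_convs restrict_apply if_True)
  qed
  have conflict: "f xs ds = 0"
    if xs: "length xs = k" "set xs \<subseteq> lc_vars \<D>" and ds: "ds \<in> ?D xs"
      and i: "i < k" "i' < k" "xs ! i = xs ! i'" "ds ! i \<noteq> ds ! i'" for xs ds i i'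
  proof -
    \<comment> \<open>Copying position \<open>i\<close> to \<open>i'\<close> fixes
      \<open>xs\<close>, but every value tuple it produces agrees at the two positions. The fibre
      over \<open>ds\<close> is thus empty.\<close>
    let ?\<sigma> = "id(i' := i)"
    have eq: "reindex k ?\<sigma> xs = xs"
      using xs i by (intro nth_equalityI) (auto simp: reindex_def)
    have "reindex k ?\<sigma> as \<noteq> ds" for as
    proof
      assume "reindex k ?\<sigma> as = ds"
      moreover have "reindex k ?\<sigma> as ! i = as ! i" "reindex k ?\<sigma> as ! i' = as ! i"
        using i by (simp_all add: reindex_def)
      ultimately show False using i by simp
    qed
    then have empty: "{as\<in>?D xs. reindex k ?\<sigma> as = ds} = {}" by blast
    have "f (reindex k ?\<sigma> xs) ds = (\<Sum>as\<in>{as\<in>?D xs. reindex k ?\<sigma> as = ds}. f xs as)"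
      by (rule reindex_con) (use xs i ds eq in auto)
    then show ?thesis unfolding eq empty by simp
  qed
  define F where "F as = f (map fst as) (map snd as)" for as
  have points: "set (map fst as) \<subseteq> lc_vars \<D>" "map snd as \<in> ?D (map fst as)" if "set as \<subseteq> ?A" for as
  proof -
    show "set (map fst as) \<subseteq> lc_vars \<D>" using that by auto
    have "fst (as ! i) \<in> lc_vars \<D> \<and> snd (as ! i) \<in> lc_dom \<D> (fst (as ! i))" if "i < length as" for i
      using nth_mem[OF that] \<open>set as \<subseteq> ?A\<close> by (auto simp: mem_Sigma_iff dest!: subsetD)
    then show "map snd as \<in> ?D (map fst as)" unfolding mem_listset_nth by simp
  qed
  have F_cong: "F bs = F as"
    if as: "set as \<subseteq> ?A" "length as = k" and bs: "set bs = set as" "length bs = k" for as bs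
  proof -
    let ?xs = "map fst as"
    \<comment> \<open>Each entry of \<open>bs\<close> is found somewhere in \<open>as\<close>, so
      \<open>bs\<close> is a reindexing of \<open>as\<close>, and \<open>F bs\<close> is a sum over
      a fibre.\<close>
    have "\<exists>l<k. bs ! i = as ! l" if "i < k" for i
      using that as bs by (metis in_set_conv_nth)
    then obtain \<sigma> where \<sigma>: "\<And>i. i < k \<Longrightarrow> \<sigma> i < k" "\<And>i. i < k \<Longrightarrow> bs ! i = as ! \<sigma> i" by metis
    have rx: "reindex k \<sigma> ?xs = map fst bs" and rd: "reindex k \<sigma> (map snd as) = map snd bs"
      using as bs \<sigma> by (auto simp: reindex_def intro!: nth_equalityI)
    have "F bs = (\<Sum>ds\<in>{ds\<in>?D ?xs. reindex k \<sigma> ds = map snd bs}. f ?xs ds)"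
      unfolding F_def rx[symmetric]
      by (rule reindex_con) (use points as bs \<sigma> rx in auto)
    also have "\<dots> = F as"
      unfolding F_def
    proof (rule sum_point)
      show "finite {ds\<in>?D ?xs. reindex k \<sigma> ds = map snd bs}"
        using finD[of ?xs] points as by simp
      show "map snd as \<in> {ds\<in>?D ?xs. reindex k \<sigma> ds = map snd bs}"
        using points as rd by simp
      \<comment> \<open>Another tuple in the fibre differs from \<open>as\<close> at some
        \<open>l\<close>. As \<open>as ! l\<close> also occurs in \<open>bs\<close>, the fibre
        condition forces its value at a position \<open>\<sigma> i\<close> with the same variable,
        so the tuple conflicts with itself.\<close>
      fix ds assume ds: "ds \<in> {ds\<in>?D ?xs. reindex k \<sigma> ds = map snd bs}" "ds \<noteq> map snd as"
      then have len: "length ds = k" using as by (simp add: mem_listset_nth)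
      then obtain l where l: "l < k" "ds ! l \<noteq> snd (as ! l)"
        using ds(2) as by (auto simp: list_eq_iff_nth_eq)
      obtain i where i: "i < k" "as ! l = bs ! i"
        using l(1) as bs by (metis in_set_conv_nth)
      have "reindex k \<sigma> ds ! i = map snd bs ! i" using ds(1) by simp
      then have "ds ! \<sigma> i = snd (bs ! i)" using i bs by (simp add: reindex_def)
      then show "f ?xs ds = 0"
        using ds(1) as l i \<sigma>[OF i(1)] points
        by (intro conflict[of ?xs ds "\<sigma> i" l]) auto
    qed
    finally show ?thesis .
  qed
  \<comment> \<open>No tuple of positive length enumerates the empty set; its value is set to 1, the
    total of \<open>f\<close> on each \<open>X\<close>-tuple.\<close>
  define g where "g S = (if S = {} then 1 else F (SOME as. set as = S \<and> length as = k))" for S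
  have gF: "g (set as) = F as" if as: "set as \<subseteq> ?A" "length as = k" for as
  proof -
    let ?bs = "SOME bs. set bs = set as \<and> length bs = k"
    have "set ?bs = set as \<and> length ?bs = k" by (rule someI[of _ as]) (simp add: as)
    then have "F ?bs = F as" by (intro F_cong as) auto
    moreover have "as \<noteq> []" using as k by auto
    ultimately show ?thesis by (simp add: g_def)
  qed
  have g0: "g {} = 1" by (simp add: g_def)
  have g_conflict: "g S = 0"
    if S: "S \<subseteq> ?A" "card S \<le> k" and ab: "(x, a) \<in> S" "(x, b) \<in> S" "a \<noteq> b" for S x a b
  proof -
    obtain as where as: "set as = S" "length as = k"
      using finite_set_as_list[OF finS[OF S(1)] _ S(2)] ab(1) by blast
    obtain i i' where i: "i < k" "as ! i = (x, a)" "i' < k" "as ! i' = (x, b)"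
      using ab as by (metis in_set_conv_nth)
    have "F as = 0"
      unfolding F_def by (rule conflict[of _ _ i i']) (use as S points i ab in auto)
    then show ?thesis using gF as S(1) by auto
  qed
  have g_marginal: "(\<Sum>a\<in>lc_dom \<D> x. g (insert (x, a) S)) = g S"
    if S: "S \<subseteq> ?A" "card S < k" and x: "x \<in> lc_vars \<D>" for S x
  proof (cases "S = {}")
    case True
    \<comment> \<open>On the constant tuple of variables, all nonconstant value tuples conflict, so
      the singletons of \<open>x\<close> carry the whole sum 1.\<close>
    let ?xs = "replicate k x"
    have xs: "length ?xs = k" "set ?xs \<subseteq> lc_vars \<D>" using x by auto
    have "g (insert (x, a) S) = f ?xs (replicate k a)" if "a \<in> lc_dom \<D> x" for a
      using gF[of "replicate k (x, a)"] that x k True by (simp add: F_def set_replicate_conv_if)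
    then have "(\<Sum>a\<in>lc_dom \<D> x. g (insert (x, a) S)) = (\<Sum>a\<in>lc_dom \<D> x. f ?xs (replicate k a))"
      by (rule sum.cong[OF refl])
    also have "\<dots> = (\<Sum>ds\<in>replicate k ` lc_dom \<D> x. f ?xs ds)"
      using k by (subst sum.reindex) (auto simp: inj_on_def)
    also have "\<dots> = (\<Sum>ds\<in>?D ?xs. f ?xs ds)"
    proof (rule sum.mono_neutral_left[OF finD[OF xs]])
      show "replicate k ` lc_dom \<D> x \<subseteq> ?D ?xs"
        unfolding mem_listset_nth subset_iff by auto
      show "\<forall>ds\<in>?D ?xs - replicate k ` lc_dom \<D> x. f ?xs ds = 0"
      proof
        fix ds assume ds: "ds \<in> ?D ?xs - replicate k ` lc_dom \<D> x"
        then have len: "length ds = k" "\<And>i. i < k \<Longrightarrow> ds ! i \<in> lc_dom \<D> x"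
          unfolding Diff_iff mem_listset_nth by auto
        have "ds \<noteq> replicate k (ds ! 0)" using ds len(2)[of 0] k by auto
        then obtain i where "i < k" "ds ! i \<noteq> ds ! 0"
          using len(1) by (auto simp: list_eq_iff_nth_eq)
        then show "f ?xs ds = 0"
          using ds by (intro conflict[OF xs, of ds i 0]) auto
      qed
    qed
    also have "\<dots> = 1" by (rule total[OF xs])
    finally show ?thesis using True g0 by simp
  next
    case False
    have "card S \<le> k - 1" using S(2) by simp
    then obtain as where as: "set as = S" "length as = k - 1"
      using finite_set_as_list[OF finS[OF S(1)] False] by blast
    have ne: "as \<noteq> []" using as False by auto
    \<comment> \<open>\<open>S\<close> is enumerated in \<open>k - 1\<close> places, which leaves
      the head for \<open>x\<close>. Forgetting the head doubles \<open>hd as\<close>, and the new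
      tuple still enumerates \<open>S\<close>.\<close>
    let ?xs = "x # map fst as" and ?\<sigma> = "\<lambda>i. if i = 0 then 1 else i :: nat"
    have xs: "length ?xs = k" "set ?xs \<subseteq> lc_vars \<D>"
      using as S x k by auto
    have rx: "reindex k ?\<sigma> ?xs = map fst (hd as # as)"
      using xs ne by (subst reindex_dup_head) (auto simp: hd_map)
    have hd_S: "hd as \<in> S" using ne as by auto
    have "g S = F (hd as # as)"
      using gF[of "hd as # as"] as S k hd_S by (simp add: insert_absorb)
    also have "\<dots> = (\<Sum>ds\<in>{ds\<in>?D ?xs. reindex k ?\<sigma> ds = map snd (hd as # as)}. f ?xs ds)"
      unfolding F_def rx[symmetric]
    proof (rule reindex_con[OF xs])
      show "?\<sigma> \<in> {..<k} \<rightarrow> {..<k}" using k by auto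
      show "map snd (hd as # as) \<in> ?D (reindex k ?\<sigma> ?xs)"
        unfolding rx by (rule points(2)) (use hd_S as S in auto)
    qed
    also have "{ds\<in>?D ?xs. reindex k ?\<sigma> ds = map snd (hd as # as)} = (\<lambda>d. d # map snd as) ` lc_dom \<D> x"
    proof (intro Set.set_eqI iffI)
      fix ds assume ds: "ds \<in> {ds\<in>?D ?xs. reindex k ?\<sigma> ds = map snd (hd as # as)}"
      then obtain d ds' where d: "ds = d # ds'" "d \<in> lc_dom \<D> x" "ds' \<in> ?D (map fst as)"
        by (auto simp: set_Cons_def)
      then have "length ds' = length as" by (simp add: mem_listset_nth)
      then have "reindex k ?\<sigma> ds = hd ds' # ds'"
        unfolding d(1) using xs ne by (intro reindex_dup_head) auto
      then show "ds \<in> (\<lambda>d. d # map snd as) ` lc_dom \<D> x" using ds d by auto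
    next
      fix ds assume "ds \<in> (\<lambda>d. d # map snd as) ` lc_dom \<D> x"
      then obtain d where d: "ds = d # map snd as" "d \<in> lc_dom \<D> x" by blast
      have "reindex k ?\<sigma> ds = map snd (hd as # as)"
        unfolding d(1) using xs ne by (subst reindex_dup_head) (auto simp: hd_map)
      then show "ds \<in> {ds\<in>?D ?xs. reindex k ?\<sigma> ds = map snd (hd as # as)}"
        using d points(2)[of as] as S by (auto simp: set_Cons_def)
    qed
    also have "(\<Sum>ds\<in>(\<lambda>d. d # map snd as) ` lc_dom \<D> x. f ?xs ds) = (\<Sum>d\<in>lc_dom \<D> x. F ((x, d) # as))"
      by (subst sum.reindex) (auto simp: inj_on_def F_def)
    also have "\<dots> = (\<Sum>d\<in>lc_dom \<D> x. g (insert (x, d) S))"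
    proof (rule sum.cong[OF refl])
      fix d assume "d \<in> lc_dom \<D> x"
      then show "F ((x, d) # as) = g (insert (x, d) S)"
        using gF[of "(x, d) # as"] as S x k by simp
    qed
    finally show ?thesis by simp
  qed
  have g_constraint_ne: "g (insert (x, b) S) = (\<Sum>a\<in>{a\<in>lc_dom \<D> y. \<alpha> a = b}. g (insert (y, a) S))"
    if S: "S \<subseteq> ?A" "card S < k" "S \<noteq> {}" and c: "(x, \<alpha>, y) \<in> lc_constraints \<D>" and b: "b \<in> lc_dom \<D> x"
    for S x \<alpha> y b
  proof -
    have "card S \<le> k - 1" using S(2) by simp
    then obtain as where as: "set as = S" "length as = k - 1"
      using finite_set_as_list[OF finS[OF S(1)] S(3)] by blast
    have xy: "x \<in> lc_vars \<D>" "y \<in> lc_vars \<D>" using c inst by (auto simp: lc_instance_def)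
    \<comment> \<open>The product of \<open>\<alpha>\<close> with identity constraints acts on the
      head and leaves the points of \<open>S\<close> fixed.\<close>
    let ?cs = "(x, \<alpha>, y) # map (\<lambda>p. (fst p, id, fst p)) as"
    have cs: "length ?cs = k" "set ?cs \<subseteq> add_id_constraints \<D>"
      using as S c k by (auto simp: add_id_constraints_def)
    have fst_cs: "map fst ?cs = map fst ((x, b) # as)" for b by simp
    have snd_cs: "map (snd \<circ> snd) ?cs = y # map fst as" by simp
    have pm: "prod_map (map (fst \<circ> snd) ?cs) (d # ds) = \<alpha> d # ds" if "length ds = length as" for d ds
      using that by (auto simp: prod_map_def intro!: nth_equalityI)
    have "g (insert (x, b) S) = F ((x, b) # as)"
      using gF[of "(x, b) # as"] as S b xy k by simp
    also have "\<dots> = (\<Sum>ds\<in>{ds\<in>?D (y # map fst as). prod_map (map (fst \<circ> snd) ?cs) ds = map snd ((x, b) # as)}.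
        f (y # map fst as) ds)"
      unfolding F_def fst_cs[symmetric] snd_cs[symmetric]
      by (rule prod_con[OF cs], unfold fst_cs[of b], rule points(2)) (use as S b xy in auto)
    also have "{ds\<in>?D (y # map fst as). prod_map (map (fst \<circ> snd) ?cs) ds = map snd ((x, b) # as)}
        = (\<lambda>a. a # map snd as) ` {a\<in>lc_dom \<D> y. \<alpha> a = b}"
    proof (intro Set.set_eqI iffI)
      fix ds assume ds: "ds \<in> {ds\<in>?D (y # map fst as). prod_map (map (fst \<circ> snd) ?cs) ds = map snd ((x, b) # as)}"
      then obtain d ds' where d: "ds = d # ds'" "d \<in> lc_dom \<D> y" "ds' \<in> ?D (map fst as)"
        by (auto simp: set_Cons_def)
      then have "length ds' = length as" by (simp add: mem_listset_nth)
      then have "prod_map (map (fst \<circ> snd) ?cs) ds = \<alpha> d # ds'" unfolding d(1) by (rule pm)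
      then show "ds \<in> (\<lambda>a. a # map snd as) ` {a\<in>lc_dom \<D> y. \<alpha> a = b}" using ds d by auto
    next
      fix ds assume "ds \<in> (\<lambda>a. a # map snd as) ` {a\<in>lc_dom \<D> y. \<alpha> a = b}"
      then obtain d where d: "ds = d # map snd as" "d \<in> lc_dom \<D> y" "\<alpha> d = b" by blast
      have "prod_map (map (fst \<circ> snd) ?cs) ds = map snd ((x, b) # as)"
        unfolding d(1) by (subst pm) (use d in auto)
      then show "ds \<in> {ds\<in>?D (y # map fst as). prod_map (map (fst \<circ> snd) ?cs) ds = map snd ((x, b) # as)}"
        using d points(2)[of as] as S by (auto simp: set_Cons_def)
    qed
    also have "(\<Sum>ds\<in>(\<lambda>a. a # map snd as) ` {a\<in>lc_dom \<D> y. \<alpha> a = b}. f (y # map fst as) ds)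
        = (\<Sum>a\<in>{a\<in>lc_dom \<D> y. \<alpha> a = b}. F ((y, a) # as))"
      by (subst sum.reindex) (auto simp: inj_on_def F_def)
    also have "\<dots> = (\<Sum>a\<in>{a\<in>lc_dom \<D> y. \<alpha> a = b}. g (insert (y, a) S))"
    proof (rule sum.cong[OF refl])
      fix a assume "a \<in> {a\<in>lc_dom \<D> y. \<alpha> a = b}"
      then show "F ((y, a) # as) = g (insert (y, a) S)"
        using gF[of "(y, a) # as"] as S xy k by simp
    qed
    finally show ?thesis .
  qed
  have g_constraint: "g (insert (x, b) S) = (\<Sum>a\<in>{a\<in>lc_dom \<D> y. \<alpha> a = b}. g (insert (y, a) S))"
    if S: "S \<subseteq> ?A" "card S < k" and c: "(x, \<alpha>, y) \<in> lc_constraints \<D>" and b: "b \<in> lc_dom \<D> x"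
    for S x \<alpha> y b
  proof (cases "S = {}")
    case True
    have xy: "x \<in> lc_vars \<D>" "y \<in> lc_vars \<D>" using c inst by (auto simp: lc_instance_def)
    let ?E = "{a\<in>lc_dom \<D> y. \<alpha> a = b}"
    \<comment> \<open>The empty case is reduced to singletons: a point of \<open>y\<close> is
      inserted by marginalisation, and the constraint is applied relative to
      \<open>{(y, a)}\<close>, which has fewer than \<open>k\<close> elements since
      \<open>k \<ge> 2\<close>. Conflicts then leave only the term \<open>a' = a\<close>.\<close>
    have "g {(x, b)} = (\<Sum>a\<in>lc_dom \<D> y. g {(y, a), (x, b)})"
      by (rule g_marginal[symmetric]) (use xy b k in auto)
    also have "\<dots> = (\<Sum>a\<in>lc_dom \<D> y. if a \<in> ?E then g {(y, a)} else 0)"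
    proof (rule sum.cong[OF refl])
      fix a assume a: "a \<in> lc_dom \<D> y"
      have "g {(y, a), (x, b)} = (\<Sum>a'\<in>?E. g {(y, a'), (y, a)})"
        using g_constraint_ne[of "{(y, a)}" x \<alpha> y b] a b c xy k by (simp add: insert_commute)
      also have "\<dots> = (\<Sum>a'\<in>?E. if a' = a then g {(y, a)} else 0)"
      proof (rule sum.cong[OF refl])
        fix a' assume "a' \<in> ?E"
        then show "g {(y, a'), (y, a)} = (if a' = a then g {(y, a)} else 0)"
          using g_conflict[of "{(y, a'), (y, a)}" y a' a] a xy k by (auto simp: card_insert_if)
      qed
      also have "\<dots> = (if a \<in> ?E then g {(y, a)} else 0)"
        using fin[OF xy(2)] by (subst sum.delta) auto
      finally show "g {(y, a), (x, b)} = (if a \<in> ?E then g {(y, a)} else 0)" .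
    qed
    also have "\<dots> = (\<Sum>a\<in>?E. g {(y, a)})"
      using fin[OF xy(2)] by (intro sum.mono_neutral_cong_right) auto
    finally show ?thesis using True by simp
  qed (use g_constraint_ne[OF S _ c b] in simp)
  show thesis by (rule that[OF g0 g_conflict g_marginal g_constraint])
qed

text \<open>The marginal and constraint equations of \<open>g\<close> are linear relations valid for
  every small \<open>S\<close>. The realising vectors inherit them at every entry, which gives the
  linear clauses of a vector system.\<close>

lemma vector_system_of_pow_solution:
  fixes \<D> :: "('x, 'd) lc"
  assumes k: "k \<ge> 2" and inst: "lc_instance \<D>"
    and sol: "has_solution (Z_minion :: ('d list, 'd list \<Rightarrow> 'p::prime_card mod_ring) minion) (lc_pow k \<D>)"
  shows "\<exists>N (u :: 'x \<times> 'd \<Rightarrow> nat \<Rightarrow> 'p mod_ring). vector_system k \<D> N u"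
proof (rule set_function_of_pow_solution[OF k inst sol])
  let ?A = "lc_points \<D>"
  have finA: "finite ?A" by (rule finite_lc_points[OF inst])
  have k0: "k > 0" using k by simp
  fix g :: "('x \<times> 'd) set \<Rightarrow> 'p mod_ring" assume g0: "g {} = 1"
    and conflict: "\<And>S x a b. S \<subseteq> ?A \<Longrightarrow> card S \<le> k \<Longrightarrow> (x, a) \<in> S \<Longrightarrow> (x, b) \<in> S \<Longrightarrow> a \<noteq> b \<Longrightarrow> g S = 0"
    and marginal: "\<And>S x. S \<subseteq> ?A \<Longrightarrow> card S < k \<Longrightarrow> x \<in> lc_vars \<D> \<Longrightarrow>
       (\<Sum>a\<in>lc_dom \<D> x. g (insert (x, a) S)) = g S"
    and constraint: "\<And>S x \<alpha> y b. S \<subseteq> ?A \<Longrightarrow> card S < k \<Longrightarrow> (x, \<alpha>, y) \<in> lc_constraints \<D> \<Longrightarrow>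
       b \<in> lc_dom \<D> x \<Longrightarrow> g (insert (x, b) S) = (\<Sum>a\<in>{a\<in>lc_dom \<D> y. \<alpha> a = b}. g (insert (y, a) S))"
  show ?thesis
  proof (rule moments_realise_set_function[of ?A g k, OF finA g0 k0])
    fix N u assume
      moments: "\<And>as. set as \<subseteq> ?A \<Longrightarrow> length as \<le> k \<Longrightarrow> moment N u as = g (set as)" and
      relations: "\<And>c\<^sub>0 c j. (\<And>S. S \<subseteq> ?A \<Longrightarrow> card S < k \<Longrightarrow> c\<^sub>0 * g S + (\<Sum>a\<in>?A. c a * g (insert a S)) = 0) \<Longrightarrow>
         j < N \<Longrightarrow> c\<^sub>0 + (\<Sum>a\<in>?A. c a * u a j) = 0"
    have fibre_sum: "(\<Sum>p\<in>?A. (if p \<in> Pair x ` E then 1 else 0) * h p) = (\<Sum>a\<in>E. h (x, a))"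
      if "x \<in> lc_vars \<D>" "E \<subseteq> lc_dom \<D> x" for x E and h :: "_ \<Rightarrow> 'p mod_ring"
      using that finA by (subst sum_indicator_mult) (auto simp: sum.reindex inj_on_def)
    have "vector_system k \<D> N u"
      unfolding vector_system_def
    proof (intro conjI ballI allI impI, goal_cases)
      case 1
      show ?case using moments[of "[]"] g0 by (simp add: moment_def)
    next
      case (2 x j)
      \<comment> \<open>The marginal equation as a relation: constant coefficient
        \<open>- 1\<close>, and coefficient 1 exactly on the points of \<open>x\<close>.\<close>
      have "- 1 + (\<Sum>p\<in>?A. (if p \<in> Pair x ` lc_dom \<D> x then 1 else 0) * u p j) = 0"
        by (rule relations) (use 2 in \<open>simp_all only: fibre_sum[OF _ subset_refl] marginal, simp_all\<close>)
      then show ?case using 2 by (simp only: fibre_sum[OF _ subset_refl] neg_eq_iff_add_eq_0) simp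
    next
      case (3 c)
      obtain x \<alpha> y where c: "c = (x, \<alpha>, y)" by (cases c)
      have xy: "x \<in> lc_vars \<D>" "y \<in> lc_vars \<D>" using 3 inst c by (auto simp: lc_instance_def)
      have "u (x, b) j = (\<Sum>a\<in>{a\<in>lc_dom \<D> y. \<alpha> a = b}. u (y, a) j)"
        if b: "b \<in> lc_dom \<D> x" and j: "j < N" for b j
      proof -
        let ?E = "{a\<in>lc_dom \<D> y. \<alpha> a = b}"
        \<comment> \<open>A difference of two indicators, so that coefficients at common points
          cancel correctly when \<open>x = y\<close>.\<close>
        let ?c = "\<lambda>p. (if p \<in> Pair x ` {b} then 1 else 0) - (if p \<in> Pair y ` ?E then 1 else 0 :: 'p mod_ring)"
        have E: "?E \<subseteq> lc_dom \<D> y" and B: "{b} \<subseteq> lc_dom \<D> x" using b by auto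
        have diff: "(\<Sum>p\<in>?A. ?c p * h p) = h (x, b) - (\<Sum>a\<in>?E. h (y, a))" for h
          unfolding left_diff_distrib sum_subtractf fibre_sum[OF xy(1) B] fibre_sum[OF xy(2) E] by simp
        have "0 + (\<Sum>p\<in>?A. ?c p * u p j) = 0"
        proof (rule relations[OF _ j])
          fix S assume S: "S \<subseteq> ?A" "card S < k"
          show "0 * g S + (\<Sum>p\<in>?A. ?c p * g (insert p S)) = 0"
            unfolding diff using constraint[OF S _ b] 3 c by simp
        qed
        then show ?thesis unfolding diff by simp
      qed
      then show ?case by (simp add: c)
    next
      case (4 as bs)
      then show ?case using moments by simp
    next
      case (5 as x a b)
      then have "card (set as) \<le> k" using card_length[of as] by linarith
      then show ?case using moments[of as] conflict[of "set as" x a b] 5 by simp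
    qed
    then show ?thesis by blast
  qed
qed

theorem theorem4p4:
  fixes k :: nat and \<D> :: "('x, 'd) lc"
  assumes "k \<ge> 2" and "lc_instance \<D>" and "lc_connected \<D>"
  shows "has_solution (VZ_minion k :: ('d, ('d, 'p::prime_card) vec_triple) minion) \<D> \<longleftrightarrow>
         has_solution (Z_minion :: ('d list, 'd list \<Rightarrow> 'p mod_ring) minion) (lc_pow k \<D>)"
  using vector_system_of_VZ_solution[OF assms] VZ_solution_of_vector_system[OF assms(1,2)]
    vector_system_of_pow_solution[OF assms(1,2)] pow_solution_of_vector_system[OF assms(2)]
  by blast

end
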